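(* Let $\mathcal{M}$ be a simply invariant subspace of $RL^1$. Then there exists a unimodular function $U$ in $RL^1$, unique up to a constant multiple of modulus one, such that $\mathcal{M} = U\,RH^1$, where $U\,RH^1=\{Uh : h\in RH^1\}$.
   Context: Let $\mathbf{T}$ be the unit circle in the complex plane and $L^p$ the Lebesgue space (of complex-valued functions) on $\mathbf{T}$ with respect to Lebesgue measure normalized so that $\mathbf{T}$ has measure $1$. For $f\in L^1$ and an integer $n$, $\hat f(n)=\int_{-\pi}^{\pi} f(e^{i\theta})e^{-in\theta}\,\frac{d\theta}{2\pi}$. $H^p$ is the subspace of $L^p$ of functions whose Fourier coefficients of negative index vanish. $RL^p=\{f\in L^p : \text{all Fourier coefficients of } f \text{ are real}\}$ and $RH^p=\{f\in H^p : \text{all Fourier coefficients of } f\text{ are real}\}$; these are regarded as real Banach spaces with the $L^p$ norm. An invariant subspace of $RL^p$ is a closed (real-linear) subspace $\mathcal{M}$ that is invariant under multiplication by the coordinate function $e^{i\theta}$, i.e. $e^{i\theta}\mathcal{M}\subseteq\mathcal{M}$. It is simply invariant if $e^{i\theta}\mathcal{M}$ is strictly contained in $\mathcal{M}$. A function $U$ is unimodular if $|U|=1$ a.e. on $\mathbf{T}$. *)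

theory Defs
  imports "HOL-Analysis.Analysis"
begin

text \<open>
  Elements of \<open>L\<^sup>1\<close> are represented by Borel measurable functions on the circle rather than by
  classes modulo a.e. equality. (Every Lebesgue measurable function is a.e. equal to a Borel
  measurable one, so the classes are the same.) A set of classes corresponds to a set of
  representatives that is closed under a.e. equality; all the sets of functions below are of
  this kind.
\<close>

definition circle :: "complex measure" where
  "circle = distr (uniform_measure lborel {-pi..pi}) (restrict_space borel (sphere 0 1)) cis"

definition L1 :: "(complex \<Rightarrow> complex) set" where
  "L1 = {f. integrable circle f}"

definition L1_norm :: "(complex \<Rightarrow> complex) \<Rightarrow> real" where
  "L1_norm f = (LINT z|circle. cmod (f z))"

definition fourier_coeff :: "(complex \<Rightarrow> complex) \<Rightarrow> int \<Rightarrow> complex" where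
  "fourier_coeff f n =
     (LINT t:{-pi..pi}|lborel. f (cis t) * cis (- (of_int n * t))) / complex_of_real (2 * pi)"

definition H1 :: "(complex \<Rightarrow> complex) set" where
  "H1 = {f \<in> L1. \<forall>n<0. fourier_coeff f n = 0}"

definition RL1 :: "(complex \<Rightarrow> complex) set" where
  "RL1 = {f \<in> L1. \<forall>n. fourier_coeff f n \<in> \<real>}"

definition RH1 :: "(complex \<Rightarrow> complex) set" where
  "RH1 = {f \<in> H1. \<forall>n. fourier_coeff f n \<in> \<real>}"

definition unimodular :: "(complex \<Rightarrow> complex) \<Rightarrow> bool" where
  "unimodular U \<longleftrightarrow> (AE z in circle. cmod (U z) = 1)"

text \<open>The set of products \<open>U h\<close> with \<open>h \<in> S\<close>, closed up under a.e. equality.\<close>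

definition mult_set :: "(complex \<Rightarrow> complex) \<Rightarrow> (complex \<Rightarrow> complex) set \<Rightarrow> (complex \<Rightarrow> complex) set"
  where "mult_set U S =
    {g \<in> borel_measurable circle. \<exists>h\<in>S. AE z in circle. g z = U z * h z}"

text \<open>
  The last condition says that \<open>M\<close> contains its closure in \<open>RL1\<close>. Since \<open>L1_norm\<close> is a seminorm
  on representatives, it also makes \<open>M\<close> closed under a.e. equality.
\<close>

definition closed_subspace_RL1 :: "(complex \<Rightarrow> complex) set \<Rightarrow> bool" where
  "closed_subspace_RL1 M \<longleftrightarrow>
     M \<subseteq> RL1 \<and>
     (\<lambda>z. 0) \<in> M \<and>
     (\<forall>f\<in>M. \<forall>g\<in>M. (\<lambda>z. f z + g z) \<in> M) \<and>
     (\<forall>c::real. \<forall>f\<in>M. (\<lambda>z. c *\<^sub>R f z) \<in> M) \<and>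
     (\<forall>f\<in>RL1. (\<forall>e>0. \<exists>g\<in>M. L1_norm (\<lambda>z. f z - g z) < e) \<longrightarrow> f \<in> M)"

definition invariant_subspace_RL1 :: "(complex \<Rightarrow> complex) set \<Rightarrow> bool" where
  "invariant_subspace_RL1 M \<longleftrightarrow> closed_subspace_RL1 M \<and> mult_set (\<lambda>z. z) M \<subseteq> M"

definition simply_invariant_subspace_RL1 :: "(complex \<Rightarrow> complex) set \<Rightarrow> bool" where
  "simply_invariant_subspace_RL1 M \<longleftrightarrow> invariant_subspace_RL1 M \<and> mult_set (\<lambda>z. z) M \<subset> M"

end

theory Submission imports Defs begin

text \<open>
  Real Fourier coefficients mean \<open>f (cnj z) = cnj (f z)\<close> almost everywhere, so the inner products below
  are real and orthogonality over the reals is orthogonality over the complex numbers. If \<open>N\<close> is a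
  shift-invariant space of square integrable functions and \<open>v\<close> is the component of some \<open>g\<close> orthogonal
  to \<open>z N\<close>, then \<open>v\<close> is orthogonal to \<open>z\<^sup>n v\<close> for \<open>n > 0\<close>; hence all Fourier coefficients of
  \<open>\<bar>v\<bar>\<^sup>2\<close> of nonzero index vanish and \<open>\<bar>v\<bar>\<close> is constant. This is used twice. Applied to the
  polynomial multiples of \<open>(1 + \<epsilon> \<bar>f\<bar>)\<close> to the power \<open>-1/2\<close>, it gives an analytic multiplier \<open>k\<close> with
  \<open>\<bar>k\<bar>\<^sup>2 (1 + \<epsilon> \<bar>f\<bar>) = 1\<close>, so that \<open>k f\<close> is square integrable and tends to \<open>f\<close> in the \<open>L\<^sup>1\<close> norm as
  \<open>\<epsilon>\<close> tends to 0. Applied to the square integrable part of \<open>M\<close>, it gives the generator \<open>U\<close>. Fejer means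
  show that \<open>M\<close> is closed under bounded analytic multipliers and contains \<open>U h\<close> for every \<open>h\<close> in \<open>RH1\<close>.
\<close>

section \<open>Integration over the circle\<close>

text \<open>The obstacle is that \<open>M\<close> lies in L1, where there is no orthogonality, and
  that an unbounded \<open>f\<close> in \<open>M\<close> can only be tamed by multipliers that keep
  it in \<open>M\<close>: analytic ones with real coefficients. The usual cure, an outer function of
  prescribed modulus, rests on logarithms and conjugate functions. Here it comes from Szego's
  extremal problem, minimising the integral of |1 - z p|^2 / w over polynomials p. The weight w = 1
  + \<epsilon> |f| is at least 1, which bounds the multiplier by 1; it dominates \<epsilon> |f|,
  which makes the product with \<open>f\<close> square integrable; and its mean tends to 1, which
  forces the multiplier towards 1. Strictness of the inclusion provides an \<open>f\<close> in
  \<open>M\<close> with \<open>cnj z * f z\<close> outside \<open>M\<close>. Approximation moves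
  this property to a square integrable \<open>g\<close>, and this is exactly what keeps the
  component of \<open>g\<close> orthogonal to the shifted space from vanishing.\<close>

lemma borel_measurable_cnj [measurable (raw)]:
  "f \<in> borel_measurable M \<Longrightarrow> (\<lambda>x. cnj (f x)) \<in> borel_measurable M"
  by (rule borel_measurable_continuous_on) (intro continuous_intros)

lemma measurable_cis_sphere: "cis \<in> borel \<rightarrow>\<^sub>M restrict_space borel (sphere 0 1)"
  by (intro measurable_restrict_space2 borel_measurable_continuous_onI continuous_intros) auto

lemma sets_circle [measurable_cong]: "sets circle = sets (restrict_space borel (sphere 0 1))"
  by (simp add: circle_def)

lemma space_circle [simp]: "space circle = sphere 0 1"
  by (simp add: circle_def space_restrict_space)

lemma borel_measurable_circle [measurable (raw)]: "f \<in> borel_measurable borel \<Longrightarrow> f \<in> borel_measurable circle"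
  by (simp add: measurable_cong_sets[OF sets_circle refl] measurable_restrict_space1)

lemma nn_integral_circle:
  assumes "f \<in> borel_measurable circle"
  shows "(\<integral>\<^sup>+z. f z \<partial>circle)
    = (\<integral>\<^sup>+t. f (cis t) * indicator {-pi..pi} t \<partial>lborel) / ennreal (2 * pi)"
proof -
  have f: "f \<in> borel_measurable (restrict_space borel (sphere 0 1))"
    using assms by (simp add: measurable_cong_sets[OF sets_circle refl])
  have fc: "(\<lambda>t. f (cis t)) \<in> borel_measurable lborel"
    using measurable_compose[OF measurable_cis_sphere f] by simp
  have "(\<integral>\<^sup>+z. f z \<partial>circle) = (\<integral>\<^sup>+t. f (cis t) \<partial>uniform_measure lborel {-pi..pi})"
    unfolding circle_def
    by (rule nn_integral_distr) (use f measurable_cis_sphere in \<open>auto simp: uniform_measure_def\<close>)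
  also have "\<dots> = (\<integral>\<^sup>+t. f (cis t) * indicator {-pi..pi} t \<partial>lborel) / ennreal (2 * pi)"
    by (subst nn_integral_uniform_measure) (use fc in auto)
  finally show ?thesis .
qed

lemma integral_circle:
  fixes f :: "complex \<Rightarrow> complex"
  assumes "f \<in> borel_measurable circle"
  shows "(LINT z|circle. f z) = (LINT t:{-pi..pi}|lborel. f (cis t)) / complex_of_real (2 * pi)"
proof -
  have f: "f \<in> borel_measurable (restrict_space borel (sphere 0 1))"
    using assms by (simp add: measurable_cong_sets[OF sets_circle refl])
  have fc: "(\<lambda>t. f (cis t)) \<in> borel_measurable lborel"
    using measurable_compose[OF measurable_cis_sphere f] by simp
  have "(LINT z|circle. f z) = (LINT t|uniform_measure lborel {-pi..pi}. f (cis t))"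
    unfolding circle_def
    by (rule integral_distr) (use f measurable_cis_sphere in \<open>auto simp: uniform_measure_def\<close>)
  also have "uniform_measure lborel {-pi..pi}
      = density lborel (\<lambda>t. ennreal (indicator {-pi..pi} t / (2 * pi)))"
    unfolding uniform_measure_def
    by (intro density_cong) (auto simp: divide_ennreal[symmetric] split: split_indicator)
  also have "(LINT t|\<dots>. f (cis t)) = (LINT t|lborel. (indicator {-pi..pi} t / (2 * pi)) *\<^sub>R f (cis t))"
    by (rule integral_density) (use fc in auto)
  also have "\<dots> = (LINT t|lborel. (indicator {-pi..pi} t *\<^sub>R f (cis t)) / complex_of_real (2 * pi))"
    by (intro Bochner_Integration.integral_cong) (auto simp: scaleR_conv_of_real)
  also have "\<dots> = (LINT t:{-pi..pi}|lborel. f (cis t)) / complex_of_real (2 * pi)"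
    unfolding set_lebesgue_integral_def by simp
  finally show ?thesis .
qed

lemma emeasure_circle_space: "emeasure circle (sphere 0 1) = 1"
proof -
  have "emeasure circle (space circle) = (\<integral>\<^sup>+z. 1 \<partial>circle)"
    by simp
  also have "\<dots> = 1"
    by (subst nn_integral_circle) (auto simp: divide_ennreal)
  finally show ?thesis by simp
qed

interpretation circle: finite_measure circle
  by standard (simp add: emeasure_circle_space)

lemma measure_circle_space [simp]: "measure circle (sphere 0 1) = 1"
  by (simp add: measure_def emeasure_circle_space)

lemma AE_circle_norm: "AE z in circle. cmod z = 1"
  by (rule AE_I2) simp

lemma measurable_power_int_circle [measurable]: "(\<lambda>z. z powi n) \<in> borel_measurable circle"
  for n :: int
proof -
  have "(\<lambda>z::complex. z powi n) \<in> borel_measurable borel"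
    unfolding power_int_def by measurable
  then show ?thesis by (rule borel_measurable_circle)
qed

lemma cnj_powi_circle: "cmod z = 1 \<Longrightarrow> cnj (z powi n) = z powi (- n)"
  by (metis complex_cnj_power_int complex_mult_cnj inverse_unique power_int_minus power_int_inverse complex_norm_square mult.commute norm_one of_real_1 power_one)

lemma norm_powi_circle: "cmod z = 1 \<Longrightarrow> cmod (z powi n) = 1"
  by (simp add: norm_power_int)

lemma powi_add_circle: "cmod z = 1 \<Longrightarrow> z powi (m + n) = z powi m * z powi n"
  by (rule power_int_add) auto

text \<open>From here on the coefficients are integrals against \<open>circle\<close>, and the angle
  integral of the definition no longer appears.\<close>

lemma fourier_coeff_eq:
  assumes "f \<in> borel_measurable circle"
  shows "fourier_coeff f n = (LINT z|circle. f z * z powi (- n))"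
proof -
  have "(LINT z|circle. f z * z powi (- n))
      = (LINT t:{-pi..pi}|lborel. f (cis t) * cis t powi (- n)) / complex_of_real (2 * pi)"
    by (rule integral_circle) (use assms in measurable)
  also have "\<dots> = fourier_coeff f n"
    by (simp add: fourier_coeff_def cis_power_int)
  finally show ?thesis ..
qed

lemma integrable_powi_mult:
  assumes "integrable circle f"
  shows "integrable circle (\<lambda>z. f z * z powi n)"
  using assms
  by (rule Bochner_Integration.integrable_bound)
    (use assms in \<open>auto simp: norm_mult norm_powi_circle intro!: AE_I2\<close>)

lemma integrable_powi: "integrable circle (\<lambda>z. z powi n)"
  using integrable_powi_mult[of "\<lambda>_. 1"] by simp

lemma integral_powi: "(LINT z|circle. z powi n) = (if n = 0 then 1 else 0)"
proof (cases "n = 0")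
  case False
  have "has_bochner_integral lborel (\<lambda>t. indicator {-pi..pi} t *\<^sub>R cis (of_int n * t))
     (cis (of_int n * pi) / (\<i> * of_int n) - cis (of_int n * (-pi)) / (\<i> * of_int n))"
  proof (rule has_bochner_integral_FTC_Icc)
    fix t :: real
    have "((\<lambda>t. exp (\<i> * of_int n * of_real t)) has_vector_derivative
        (\<i> * of_int n) * exp (\<i> * of_int n * of_real t)) (at t within {-pi..pi})"
      by (auto intro!: derivative_eq_intros has_vector_derivative_real_field)
    from has_vector_derivative_divide[OF this, of "\<i> * of_int n"]
    show "((\<lambda>t. cis (of_int n * t) / (\<i> * of_int n)) has_vector_derivative cis (of_int n * t))
        (at t within {-pi..pi})"
      using False by (simp add: cis_conv_exp mult.assoc)
  qed (auto intro!: continuous_intros)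
  moreover have "cis (of_int n * pi) = cis (of_int n * (-pi))"
    by (simp add: complex_eq_iff)
      (metis mult.commute sin_npi_int minus_zero)
  ultimately have "(LINT t:{-pi..pi}|lborel. cis (of_int n * t)) = 0"
    unfolding set_lebesgue_integral_def by (simp add: has_bochner_integral_integral_eq)
  then show ?thesis
    using False by (simp add: integral_circle cis_power_int)
qed simp

section \<open>Invariance of the circle measure under conjugation\<close>

lemma cnj_measurable_circle [measurable]: "cnj \<in> circle \<rightarrow>\<^sub>M circle"
proof -
  have "cnj \<in> borel_measurable borel"
    by (intro borel_measurable_continuous_onI continuous_intros)
  then have "cnj \<in> circle \<rightarrow>\<^sub>M restrict_space borel (sphere 0 1)"
    by (intro measurable_restrict_space2 borel_measurable_circle) auto
  then show ?thesis by (simp add: measurable_cong_sets[OF refl sets_circle])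
qed

text \<open>In the angle, conjugation is the reflection t to -t, which preserves Lebesgue measure
  and the symmetric interval \<open>{-pi..pi}\<close>. The pointwise form of real Fourier
  coefficients compares \<open>f z\<close> with \<open>f (cnj z)\<close>, so this invariance
  underlies every use of it.\<close>

lemma distr_cnj_circle: "distr circle circle cnj = circle"
proof (rule measure_eqI)
  fix A assume "A \<in> sets (distr circle circle cnj)"
  then have [measurable]: "A \<in> sets circle" by simp
  have c [measurable]: "cnj \<in> borel_measurable borel"
    by (intro borel_measurable_continuous_onI continuous_intros)
  have i [measurable]: "indicator A \<in> borel_measurable circle"
    by measurable
  have i2 [measurable]: "(\<lambda>z. indicator A (cnj z)) \<in> borel_measurable circle"
    by measurable
  then have "(\<lambda>z. indicator A (cnj z)) \<in> borel_measurable (restrict_space borel (sphere 0 1))"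
    by (simp add: measurable_cong_sets[OF sets_circle refl])
  from measurable_compose[OF measurable_cis_sphere this]
  have m: "(\<lambda>t. indicator A (cis (- t)) :: ennreal) \<in> borel_measurable borel"
    by (simp add: cis_cnj)
  have "emeasure (distr circle circle cnj) A = (\<integral>\<^sup>+z. indicator A z \<partial>distr circle circle cnj)"
    by simp
  also have "\<dots> = (\<integral>\<^sup>+z. indicator A (cnj z) \<partial>circle)"
    by (rule nn_integral_distr) measurable
  also have "\<dots> = (\<integral>\<^sup>+t. indicator A (cis (- t)) * indicator {-pi..pi} t \<partial>lborel) / ennreal (2 * pi)"
    by (subst nn_integral_circle) (auto simp: cis_cnj)
  also have "(\<integral>\<^sup>+t. indicator A (cis (- t)) * indicator {-pi..pi} t \<partial>lborel)
      = (\<integral>\<^sup>+t. indicator A (cis t) * indicator {-pi..pi} (- t) \<partial>lborel)"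
    by (subst nn_integral_real_affine[where c = "-1" and t = 0]) (use m in auto)
  also have "\<dots> = (\<integral>\<^sup>+t. indicator A (cis t) * indicator {-pi..pi} t \<partial>lborel)"
    by (intro nn_integral_cong) (auto split: split_indicator)
  also have "\<dots> / ennreal (2 * pi) = (\<integral>\<^sup>+z. indicator A z \<partial>circle)"
    by (rule nn_integral_circle[symmetric]) measurable
  finally show "emeasure (distr circle circle cnj) A = emeasure circle A"
    by simp
qed simp

lemma integral_circle_cnj:
  fixes f :: "complex \<Rightarrow> complex"
  assumes "f \<in> borel_measurable circle"
  shows "(LINT z|circle. f (cnj z)) = (LINT z|circle. f z)"
  using integral_distr[OF cnj_measurable_circle assms] by (simp add: distr_cnj_circle)

lemma AE_circle_cnj:
  assumes "AE z in circle. P z"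
  shows "AE z in circle. P (cnj z)"
proof -
  have "AE z in distr circle circle cnj. P z"
    using assms by (simp only: distr_cnj_circle)
  then show ?thesis
    by (rule AE_distrD[rotated]) measurable
qed

lemma integrable_circle_cnj:
  fixes f :: "complex \<Rightarrow> complex"
  assumes "integrable circle f"
  shows "integrable circle (\<lambda>z. f (cnj z))"
  using integrable_distr[OF cnj_measurable_circle, of f] assms by (simp add: distr_cnj_circle)

section \<open>Density of trigonometric polynomials\<close>

inductive trig_poly :: "(complex \<Rightarrow> complex) \<Rightarrow> bool" where
  monomial: "trig_poly (\<lambda>z. c * z powi n)"
| add: "trig_poly f \<Longrightarrow> trig_poly g \<Longrightarrow> trig_poly (\<lambda>z. f z + g z)"

lemma integrable_trig_poly: "trig_poly f \<Longrightarrow> integrable circle f"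
  by (induction rule: trig_poly.induct) (auto intro: integrable_powi)

text \<open>Equality is claimed on the circle only, because the addition law for exponents of
  \<open>powi\<close> fails at 0.\<close>

lemma trig_poly_mult_monomial:
  "trig_poly f \<Longrightarrow> \<exists>h. trig_poly h \<and> (\<forall>z\<in>sphere 0 1. h z = f z * (c * z powi n))"
proof (induction rule: trig_poly.induct)
  case (monomial d m)
  show ?case
    by (rule exI[of _ "\<lambda>z. (d * c) * z powi (m + n)"])
      (auto simp: powi_add_circle intro: trig_poly.monomial)
next
  case (add f g)
  then obtain h k where
    "trig_poly h" "\<forall>z\<in>sphere 0 1. h z = f z * (c * z powi n)"
    "trig_poly k" "\<forall>z\<in>sphere 0 1. k z = g z * (c * z powi n)" by blast
  then show ?case
    by (intro exI[of _ "\<lambda>z. h z + k z"]) (auto simp: distrib_right intro: trig_poly.add)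
qed

lemma trig_poly_mult:
  assumes "trig_poly g" "trig_poly f"
  shows "\<exists>h. trig_poly h \<and> (\<forall>z\<in>sphere 0 1. h z = f z * g z)"
  using assms(1)
proof (induction rule: trig_poly.induct)
  case (monomial c n)
  show ?case by (rule trig_poly_mult_monomial[OF assms(2)])
next
  case (add g1 g2)
  then obtain h k where
    "trig_poly h" "\<forall>z\<in>sphere 0 1. h z = f z * g1 z"
    "trig_poly k" "\<forall>z\<in>sphere 0 1. k z = f z * g2 z" by blast
  then show ?case
    by (intro exI[of _ "\<lambda>z. h z + k z"]) (auto simp: distrib_left intro: trig_poly.add)
qed

text \<open>Connects the Stone-Weierstrass theorem, which speaks of real polynomials in the
  coordinates of the plane, with the characters of the circle.\<close>

lemma real_polynomial_function_trig_poly: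
  assumes "real_polynomial_function p"
  shows "\<exists>h. trig_poly h \<and> (\<forall>z\<in>sphere 0 1. h z = complex_of_real (p z))"
  using assms
proof (induction rule: real_polynomial_function.induct)
  case (linear p)
  interpret p: bounded_linear p by (rule linear)
  \<comment> \<open>Chosen so that 2 Re (a z) = Re z * p 1 + Im z * p \<i>, with
    \<open>cnj z\<close> being the inverse of z on the circle.\<close>
  define a where "a = (complex_of_real (p 1) - \<i> * complex_of_real (p \<i>)) / 2"
  have "a * z powi 1 + cnj a * z powi (- 1) = complex_of_real (p z)" if "z \<in> sphere 0 1" for z
  proof -
    have "z = Re z *\<^sub>R 1 + Im z *\<^sub>R \<i>" by (simp add: complex_eq_iff)
    then have "p z = Re z * p 1 + Im z * p \<i>"
      by (metis p.add p.scaleR real_scaleR_def)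
    moreover have "z powi (- 1) = cnj z"
      using cnj_powi_circle[of z 1] that by simp
    ultimately show ?thesis
      by (simp add: a_def complex_eq_iff) (simp add: field_simps)
  qed
  then show ?case
    by (intro exI[of _ "\<lambda>z. a * z powi 1 + cnj a * z powi (- 1)"] conjI trig_poly.intros) auto
next
  case (const c)
  show ?case
    using trig_poly.monomial[of "complex_of_real c" 0] by (intro exI) auto
next
  case (add p q)
  then obtain h k where
    "trig_poly h" "\<forall>z\<in>sphere 0 1. h z = complex_of_real (p z)"
    "trig_poly k" "\<forall>z\<in>sphere 0 1. k z = complex_of_real (q z)" by blast
  then show ?case
    by (intro exI[of _ "\<lambda>z. h z + k z"]) (auto intro: trig_poly.add)
next
  case (mult p q)
  then obtain h k where
    hk: "trig_poly h" "\<forall>z\<in>sphere 0 1. h z = complex_of_real (p z)"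
    "trig_poly k" "\<forall>z\<in>sphere 0 1. k z = complex_of_real (q z)" by blast
  from trig_poly_mult[OF hk(3) hk(1)] show ?case
    using hk by auto
qed

lemma tendsto_integral_norm_0:
  fixes u :: "nat \<Rightarrow> 'a \<Rightarrow> 'b::{banach, second_countable_topology}"
  assumes [measurable]: "\<And>n. u n \<in> borel_measurable M"
    and "integrable M w" and "AE x in M. (\<lambda>n. u n x) \<longlonglongrightarrow> 0" and "\<And>n. AE x in M. norm (u n x) \<le> w x"
  shows "(\<lambda>n. LINT x|M. norm (u n x)) \<longlonglongrightarrow> 0"
proof -
  have "(\<lambda>n. LINT x|M. norm (u n x)) \<longlonglongrightarrow> (LINT x|M. norm (0::'b))"
    by (rule integral_dominated_convergence[where w = w])
      (use assms in \<open>auto intro: tendsto_norm_zero elim!: eventually_mono\<close>)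
  then show ?thesis by simp
qed

text \<open>The characters span a dense subspace of L1. The class of functions with \<open>P\<close>
  grows from trigonometric polynomials to continuous functions by uniform approximation, to
  indicators of closed sets by pointwise limits, to Borel indicators by the pi-lambda theorem, and
  then to all integrable functions.\<close>

lemma circle_L1_induct [consumes 1, case_names add scale powi closed]:
  assumes f: "integrable circle f"
    and add: "\<And>f g. integrable circle f \<Longrightarrow> P f \<Longrightarrow> integrable circle g \<Longrightarrow> P g \<Longrightarrow> P (\<lambda>z. f z + g z)"
    and scale: "\<And>c f. integrable circle f \<Longrightarrow> P f \<Longrightarrow> P (\<lambda>z. c * f z)"
    and powi: "\<And>n. P (\<lambda>z. z powi n)"
    and closed: "\<And>f. integrable circle f \<Longrightarrow>
      (\<And>e. e > 0 \<Longrightarrow> \<exists>g. integrable circle g \<and> P g \<and> (LINT z|circle. cmod (f z - g z)) < e) \<Longrightarrow> P f"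
  shows "P f"
proof -
  \<comment> \<open>Dominated pointwise limits are L1 limits, so the closure rule also covers them;
    most limits below have this form.\<close>
  have L1_lim: "P f"
    if int: "\<And>n. integrable circle (s n)" and P: "\<And>n. P (s n)"
      and f [measurable]: "integrable circle f" and w: "integrable circle w"
      and conv: "AE z in circle. (\<lambda>n. s n z) \<longlonglongrightarrow> f z"
      and bound: "\<And>n. AE z in circle. cmod (s n z) \<le> w z" for f s w
  proof (rule closed[OF f])
    have [measurable]: "s n \<in> borel_measurable circle" for n
      using int by auto
    fix e :: real assume "e > 0"
    have "(\<lambda>n. LINT z|circle. cmod (f z - s n z)) \<longlonglongrightarrow> 0"
    proof (rule tendsto_integral_norm_0)
      show "integrable circle (\<lambda>z. cmod (f z) + w z)" using f w by auto
      show "AE z in circle. (\<lambda>n. f z - s n z) \<longlonglongrightarrow> 0"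
        using conv
      proof eventually_elim
        case (elim z)
        from tendsto_diff[OF tendsto_const[of "f z"] elim] show ?case by simp
      qed
      show "AE z in circle. cmod (f z - s n z) \<le> cmod (f z) + w z" for n
        using bound[of n]
      proof eventually_elim
        case (elim z)
        with norm_triangle_ineq4[of "f z" "s n z"] show ?case by simp
      qed
    qed (use f in measurable)
    then have "\<forall>\<^sub>F n in sequentially. (LINT z|circle. cmod (f z - s n z)) < e"
      using \<open>e > 0\<close> by (rule order_tendstoD)
    from eventually_happens'[OF sequentially_bot this]
    obtain n where n: "(LINT z|circle. cmod (f z - s n z)) < e" ..
    show "\<exists>g. integrable circle g \<and> P g \<and> (LINT z|circle. cmod (f z - g z)) < e"
      by (rule exI[of _ "s n"]) (intro conjI int P n)
  qed
  \<comment> \<open>Invariance under a.e. equality is the case of a constant sequence.\<close>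
  have cong: "P f" if "P g" "integrable circle g" "f \<in> borel_measurable circle" "AE z in circle. g z = f z" for f g
  proof (rule L1_lim[of "\<lambda>_. g" f "\<lambda>z. cmod (g z)"])
    show "integrable circle f"
      using integrable_cong_AE[OF borel_measurable_integrable[OF that(2)] that(3,4)] that(2) by simp
    show "AE z in circle. (\<lambda>n. g z) \<longlonglongrightarrow> f z"
      using that(4) by eventually_elim simp
  qed (use that in auto)
  have trig: "P h" if "trig_poly h" for h
    using that
    by (induction rule: trig_poly.induct) (auto intro: add scale powi integrable_powi integrable_trig_poly)
  have cont: "P (\<lambda>z. complex_of_real (g z))" if g: "continuous_on UNIV g" for g :: "complex \<Rightarrow> real"
  proof -
    have gm [measurable]: "g \<in> borel_measurable borel"
      using g by (rule borel_measurable_continuous_onI)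
    have gm' [measurable]: "g \<in> borel_measurable circle"
      by (rule borel_measurable_circle) measurable
    have "compact (g ` sphere 0 1)"
      by (intro compact_continuous_image continuous_on_subset[OF g]) auto
    then obtain B where B: "\<And>z. cmod z = 1 \<Longrightarrow> \<bar>g z\<bar> \<le> B"
      using compact_imp_bounded bounded_iff by (force simp: bounded_iff)
    have gi: "integrable circle (\<lambda>z. complex_of_real (g z))"
      by (rule circle.integrable_const_bound[of _ B]) (use B in \<open>auto intro!: AE_I2\<close>)
    show ?thesis
    proof (rule closed[OF gi])
      fix e :: real assume e: "e > 0"
      obtain p where p: "real_polynomial_function p" "\<And>z. z \<in> sphere 0 1 \<Longrightarrow> \<bar>g z - p z\<bar> < e / 2"
        using Stone_Weierstrass_real_polynomial_function[of "sphere 0 1" g "e / 2"] e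
          continuous_on_subset[OF g] by auto
      obtain h where h: "trig_poly h" "\<forall>z\<in>sphere 0 1. h z = complex_of_real (p z)"
        using real_polynomial_function_trig_poly[OF p(1)] by auto
      have hi: "integrable circle h" by (rule integrable_trig_poly[OF h(1)])
      have "cmod (complex_of_real (g z) - h z) \<le> e / 2" if "z \<in> sphere 0 1" for z
        using h(2) p(2)[OF that] that by (simp flip: of_real_diff)
      then have "(LINT z|circle. cmod (complex_of_real (g z) - h z)) \<le> (LINT z|circle. e / 2)"
        by (intro integral_mono_AE AE_I2) (use gi hi in auto)
      also have "\<dots> < e" using e by simp
      finally show "\<exists>h. integrable circle h \<and> P h
          \<and> (LINT z|circle. cmod (complex_of_real (g z) - h z)) < e"
        using hi trig[OF h(1)] by blast
    qed
  qed
  have ind_int: "integrable circle (indicator B :: complex \<Rightarrow> complex)" if "B \<in> sets borel" for B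
  proof (rule circle.integrable_const_bound[of _ 1])
    show "(indicator B :: complex \<Rightarrow> complex) \<in> borel_measurable circle"
      by (rule borel_measurable_circle) (use that in measurable)
  qed (auto intro!: AE_I2 split: split_indicator)
  have P_empty: "P (indicator {})"
    using scale[OF integrable_powi powi, of 0 0] by (simp add: indicator_def[abs_def])
  have ind: "P (indicator B)" if "B \<in> sets borel" for B
  proof -
    \<comment> \<open>The closed sets form an intersection-stable generator of the Borel sets, so
      only complements and disjoint countable unions remain.\<close>
    have "Int_stable (Collect closed :: complex set set)"
      by (auto simp: Int_stable_def)
    moreover have "(Collect closed :: complex set set) \<subseteq> Pow UNIV"
      by simp
    moreover have "B \<in> sigma_sets UNIV (Collect closed)"
      using that by (simp add: borel_eq_closed)
    ultimately show ?thesis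
    proof (induction rule: sigma_sets_induct_disjoint)
      case (basic A)
      then have A: "closed A" by simp
      show ?case
      \<comment> \<open>The empty set is separated because \<open>infdist z {}\<close> is 0 by
        convention, and the functions used below would then be constantly 1.\<close>
      proof (cases "A = {}")
        case True
        then show ?thesis using P_empty by (simp add: indicator_def[abs_def])
      next
        case False
        show ?thesis
        proof (rule L1_lim)
          \<comment> \<open>Continuous functions equal to 1 on \<open>A\<close> that vanish at
            distance 1/n or more from \<open>A\<close>. As \<open>A\<close> is closed, a point
            outside has positive distance and the values there are eventually 0.\<close>
          let ?s = "\<lambda>n z. complex_of_real (max 0 (1 - real n * infdist z A))"
          show "P (?s n)" for n
            by (rule cont) (intro continuous_intros)
          have m: "?s n \<in> borel_measurable circle" for n
            by (intro borel_measurable_circle borel_measurable_continuous_onI continuous_intros)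
          show b: "AE z in circle. cmod (?s n z) \<le> 1" for n
            by (rule AE_I2) (simp add: infdist_nonneg)
          show "integrable circle (?s n)" for n
            by (rule circle.integrable_const_bound[OF b m])
          show "AE z in circle. (\<lambda>n. ?s n z) \<longlonglongrightarrow> indicator A z"
          proof (rule AE_I2)
            fix z :: complex
            show "(\<lambda>n. ?s n z) \<longlonglongrightarrow> indicator A z"
            proof (cases "z \<in> A")
              case True
              then show ?thesis by simp
            next
              case out: False
              then have d: "infdist z A > 0"
                using A False by (simp add: infdist_pos_not_in_closed)
              obtain N where N: "1 / infdist z A < real N"
                using reals_Archimedean2 by blast
              have "?s n z = 0" if "n \<ge> N" for n
              proof -
                have "1 / infdist z A < real n" using N that by simp
                then show ?thesis using d by (simp add: field_simps max_def)
              qed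
              then have "\<forall>\<^sub>F n in sequentially. ?s n z = 0"
                by (auto simp: eventually_sequentially)
              then show ?thesis
                using out by (simp add: tendsto_eventually)
            qed
          qed
        qed (use A in \<open>auto intro!: ind_int borel_closed\<close>)
      qed
    next
      case empty
      show ?case using P_empty by (simp add: indicator_def[abs_def])
    next
      case (compl A)
      then have A: "A \<in> sets borel" by (simp add: borel_eq_closed)
      \<comment> \<open>The constant 1 is written as the character of index 0, so that the rules for
        \<open>P\<close> apply.\<close>
      have "P (\<lambda>z. z powi 0 + (- 1) * indicator A z)"
        by (intro add scale powi compl) (use ind_int[OF A] in \<open>auto intro: integrable_powi\<close>)
      also have "(\<lambda>z. z powi 0 + (- 1) * indicator A z) = (indicator (UNIV - A) :: complex \<Rightarrow> complex)"
        by (auto split: split_indicator)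
      finally show ?case .
    next
      case (union A)
      then have A: "\<And>i. A i \<in> sets borel" by (auto simp: borel_eq_closed)
      have fin: "P (indicator (\<Union>i<n. A i))" for n
      proof (induction n)
        case 0
        show ?case using P_empty by (simp add: indicator_def[abs_def])
      next
        case (Suc n)
        have U: "(\<Union>i<n. A i) \<in> sets borel" using A by auto
        have "P (\<lambda>z. indicator (\<Union>i<n. A i) z + indicator (A n) z)"
          by (intro add Suc union ind_int U A)
        also have "(\<lambda>z. indicator (\<Union>i<n. A i) z + indicator (A n) z)
          = (indicator (\<Union>i<Suc n. A i) :: complex \<Rightarrow> complex)"
        proof
          fix z
          have "A n \<inter> (\<Union>i<n. A i) = {}"
            using union(1) by (auto simp: disjoint_family_on_def) (metis IntI emptyE less_irrefl)
          then show "indicator (\<Union>i<n. A i) z + indicator (A n) z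
              = (indicator (\<Union>i<Suc n. A i) z :: complex)"
            by (auto simp: lessThan_Suc split: split_indicator)
        qed
        finally show ?case .
      qed
      show ?case
      proof (rule L1_lim[OF _ fin])
        show "integrable circle (indicator (\<Union>i<n. A i) :: complex \<Rightarrow> complex)" for n
          using A by (intro ind_int) auto
        show "integrable circle (indicator (\<Union>i. A i) :: complex \<Rightarrow> complex)"
          using A by (intro ind_int) auto
        show "AE z in circle. (\<lambda>n. indicator (\<Union>i<n. A i) z :: complex) \<longlonglongrightarrow> indicator (\<Union>i. A i) z"
          by (rule AE_I2) (rule LIMSEQ_indicator_UN)
        show "integrable circle (\<lambda>_. 1)" by simp
      qed (auto intro!: AE_I2 split: split_indicator)
    qed
  qed
  show ?thesis
    using f
  proof (induction rule: integrable_induct)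
    case (base A c)
    then obtain B where B: "B \<in> sets borel" "A = sphere 0 1 \<inter> B"
      by (auto simp: sets_circle sets_restrict_space)
    have "P (\<lambda>z. c * indicator B z)"
      by (intro scale ind ind_int B)
    then show ?case
    proof (rule cong)
      show "integrable circle (\<lambda>z. c * indicator B z)" using ind_int[OF B(1)] by auto
      show "AE z in circle. c * indicator B z = indicat_real A z *\<^sub>R c"
        by (rule AE_I2) (use B in \<open>auto split: split_indicator\<close>)
    qed (use base in measurable)
  next
    case (add f g)
    then show ?case by (intro assms(2))
  next
    case (lim f s)
    show ?case
      by (rule L1_lim[of s f "\<lambda>z. 2 * cmod (f z)"]) (use lim in auto)
  qed
qed

section \<open>Fejer means\<close>

lemma fourier_coeff_add:
  assumes "integrable circle f" "integrable circle g"
  shows "fourier_coeff (\<lambda>z. f z + g z) n = fourier_coeff f n + fourier_coeff g n"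
proof -
  have "(LINT z|circle. f z * z powi (- n) + g z * z powi (- n))
      = (LINT z|circle. f z * z powi (- n)) + (LINT z|circle. g z * z powi (- n))"
    by (intro Bochner_Integration.integral_add integrable_powi_mult assms)
  then show ?thesis
    using assms by (simp add: fourier_coeff_eq distrib_right)
qed

lemma fourier_coeff_cmult:
  assumes "integrable circle f"
  shows "fourier_coeff (\<lambda>z. c * f z) n = c * fourier_coeff f n"
  using assms by (simp add: fourier_coeff_eq mult.assoc)

lemma fourier_coeff_diff:
  assumes "integrable circle f" "integrable circle g"
  shows "fourier_coeff (\<lambda>z. f z - g z) n = fourier_coeff f n - fourier_coeff g n"
proof -
  have "(LINT z|circle. f z * z powi (- n) - g z * z powi (- n))
      = (LINT z|circle. f z * z powi (- n)) - (LINT z|circle. g z * z powi (- n))"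
    by (intro Bochner_Integration.integral_diff integrable_powi_mult assms)
  then show ?thesis
    using assms by (simp add: fourier_coeff_eq left_diff_distrib)
qed

lemma fourier_coeff_cong_AE:
  assumes "f \<in> borel_measurable circle" "g \<in> borel_measurable circle" "AE z in circle. f z = g z"
  shows "fourier_coeff f n = fourier_coeff g n"
proof -
  have "(LINT z|circle. f z * z powi (- n)) = (LINT z|circle. g z * z powi (- n))"
  proof (rule integral_cong_AE)
    show "AE z in circle. f z * z powi (- n) = g z * z powi (- n)"
      using assms(3) by eventually_elim simp
  qed (use assms in measurable)
  then show ?thesis using assms by (simp add: fourier_coeff_eq)
qed

lemma fourier_coeff_mult_powi:
  assumes "f \<in> borel_measurable circle"
  shows "fourier_coeff (\<lambda>z. f z * z powi m) n = fourier_coeff f (n - m)"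
proof -
  have "(LINT z|circle. f z * z powi m * z powi (- n)) = (LINT z|circle. f z * z powi (- (n - m)))"
  proof (intro Bochner_Integration.integral_cong refl)
    fix z assume "z \<in> space circle"
    then show "f z * z powi m * z powi (- n) = f z * z powi (- (n - m))"
      using powi_add_circle[of z m "- n"] by simp
  qed
  moreover have "(\<lambda>z. f z * z powi m) \<in> borel_measurable circle"
    using assms by measurable
  ultimately show ?thesis using assms by (simp add: fourier_coeff_eq)
qed

lemma fourier_coeff_powi: "fourier_coeff (\<lambda>z. z powi m) n = (if m = n then 1 else 0)"
proof -
  have "fourier_coeff (\<lambda>z. 1 * z powi m) n = fourier_coeff (\<lambda>_. 1) (n - m)"
    by (rule fourier_coeff_mult_powi) simp
  also have "\<dots> = (if m = n then 1 else 0)"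
    using integral_powi[of "m - n"] by (simp add: fourier_coeff_eq)
  finally show ?thesis by simp
qed

text \<open>The index n = i - j occurs N - |n| times, so this is the usual mean with weights 1 -
  |n|/N. The double sum matches the expansion of the squared modulus in the kernel. For N = 0 the
  value is 0.\<close>

definition fejer_mean :: "nat \<Rightarrow> (complex \<Rightarrow> complex) \<Rightarrow> complex \<Rightarrow> complex" where
  "fejer_mean N f z =
    (\<Sum>i<N. \<Sum>j<N. fourier_coeff f (int i - int j) * z powi (int i - int j)) / of_nat N"

text \<open>The classical Fejer kernel at the quotient x / y of two points of the circle. As a
  squared modulus it is visibly nonnegative, and keeping both points as arguments makes its symmetry
  available to Fubini.\<close>

definition fejer_kernel :: "nat \<Rightarrow> complex \<Rightarrow> complex \<Rightarrow> real" where
  "fejer_kernel N x y = (cmod (\<Sum>j<N. (x * cnj y) ^ j))\<^sup>2 / real N"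

lemma fejer_kernel_nonneg: "fejer_kernel N x y \<ge> 0"
  by (simp add: fejer_kernel_def)

lemma fejer_kernel_commute: "fejer_kernel N x y = fejer_kernel N y x"
proof -
  have "cnj (\<Sum>j<N. (x * cnj y) ^ j) = (\<Sum>j<N. (y * cnj x) ^ j)"
    by (simp add: mult.commute)
  then show ?thesis
    unfolding fejer_kernel_def by (metis complex_mod_cnj)
qed

lemma fejer_kernel_expand:
  assumes "cmod x = 1" "cmod y = 1"
  shows "complex_of_real (fejer_kernel N x y)
    = (\<Sum>i<N. \<Sum>j<N. x powi (int i - int j) * y powi (- (int i - int j))) / of_nat N"
proof -
  have "(x * cnj y) ^ i * cnj ((x * cnj y) ^ j)
      = x powi (int i - int j) * y powi (- (int i - int j))" for i j
  proof -
    have "x powi (int i - int j) = x ^ i * cnj x ^ j"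
      using powi_add_circle[of x "int i" "- int j"] cnj_powi_circle[of x "int j"] assms by simp
    moreover have "y powi (- (int i - int j)) = cnj y ^ i * y ^ j"
      using powi_add_circle[of y "- int i" "int j"] cnj_powi_circle[of y "int i"] assms by simp
    ultimately show ?thesis
      by (simp add: power_mult_distrib mult_ac)
  qed
  then have "(\<Sum>j<N. (x * cnj y) ^ j) * cnj (\<Sum>j<N. (x * cnj y) ^ j)
      = (\<Sum>i<N. \<Sum>j<N. x powi (int i - int j) * y powi (- (int i - int j)))"
    by (simp add: sum_product cnj_sum del: complex_cnj_mult complex_cnj_power)
  then show ?thesis
    unfolding fejer_kernel_def of_real_divide complex_norm_square by simp
qed

lemma measurable_fejer_kernel [measurable]:
  "(\<lambda>p. fejer_kernel N (fst p) (snd p)) \<in> borel_measurable (circle \<Otimes>\<^sub>M circle)"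
proof -
  have [measurable]: "fst \<in> borel_measurable (circle \<Otimes>\<^sub>M circle)" "snd \<in> borel_measurable (circle \<Otimes>\<^sub>M circle)"
    using measurable_compose[OF measurable_fst borel_measurable_circle[OF measurable_ident]]
      measurable_compose[OF measurable_snd borel_measurable_circle[OF measurable_ident]]
    by (simp_all add: id_def)
  have "cnj \<in> borel_measurable borel"
    by (intro borel_measurable_continuous_onI continuous_intros)
  then have [measurable]: "(\<lambda>p. cnj (snd p)) \<in> borel_measurable (circle \<Otimes>\<^sub>M circle)"
    by measurable
  show ?thesis unfolding fejer_kernel_def by measurable
qed

lemma fejer_mean_eq_integral:
  \<comment> \<open>The mean is a convolution with the kernel; the sum is finite, so it passes
    through the integral.\<close>
  assumes f: "integrable circle f" and x: "cmod x = 1"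
  shows "fejer_mean N f x = (LINT y|circle. f y * complex_of_real (fejer_kernel N x y))"
proof -
  have "(LINT y|circle. f y * complex_of_real (fejer_kernel N x y))
      = (LINT y|circle. (\<Sum>i<N. \<Sum>j<N. x powi (int i - int j) * (f y * y powi (- (int i - int j)))) / of_nat N)"
  proof (intro Bochner_Integration.integral_cong refl)
    fix y assume "y \<in> space circle"
    then show "f y * complex_of_real (fejer_kernel N x y)
        = (\<Sum>i<N. \<Sum>j<N. x powi (int i - int j) * (f y * y powi (- (int i - int j)))) / of_nat N"
      using fejer_kernel_expand[OF x, of y N]
      by (simp add: sum_distrib_left mult_ac)
  qed
  also have "\<dots> = (\<Sum>i<N. \<Sum>j<N. x powi (int i - int j) * (LINT y|circle. f y * y powi (- (int i - int j)))) / of_nat N"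
    using integrable_powi_mult[OF f] by (simp add: Bochner_Integration.integral_sum)
  also have "\<dots> = fejer_mean N f x"
    unfolding fejer_mean_def using f by (simp add: fourier_coeff_eq mult.commute)
  finally show ?thesis ..
qed

lemma integrable_mult_fejer_kernel:
  assumes f: "integrable circle f" and x: "cmod x = 1"
  shows "integrable circle (\<lambda>y. f y * complex_of_real (fejer_kernel N x y))"
proof -
  have "integrable circle
      (\<lambda>y. (\<Sum>i<N. \<Sum>j<N. x powi (int i - int j) * (f y * y powi (- (int i - int j)))) / of_nat N)"
    by (intro integrable_divide_zero Bochner_Integration.integrable_sum integrable_mult_right
        integrable_powi_mult f)
  then show ?thesis
    by (rule Bochner_Integration.integrable_cong[THEN iffD1, rotated -1])
      (auto simp: fejer_kernel_expand[OF x] sum_distrib_left mult_ac)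
qed

lemma integrable_fejer_kernel: "cmod x = 1 \<Longrightarrow> integrable circle (fejer_kernel N x)"
  using integrable_Re[OF integrable_mult_fejer_kernel[of "\<lambda>_. 1" x N]] by simp

lemma integral_fejer_kernel:
  assumes "cmod x = 1" "N > 0"
  shows "(LINT y|circle. fejer_kernel N x y) = 1"
proof -
  have "fejer_mean N (\<lambda>_. 1) x = 1"
  proof -
    have "fourier_coeff (\<lambda>_. 1) n = (if n = 0 then 1 else 0)" for n
      using fourier_coeff_powi[of 0 n] by auto
    then have "fejer_mean N (\<lambda>_. 1) x = (\<Sum>i<N. \<Sum>j<N. if i = j then 1 else 0) / of_nat N"
      unfolding fejer_mean_def
      by (intro arg_cong2[where f = "(/)"] sum.cong refl) auto
    then show ?thesis using assms by (simp add: sum.delta)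
  qed
  then have "complex_of_real (LINT y|circle. fejer_kernel N x y) = 1"
    using fejer_mean_eq_integral[of "\<lambda>_. 1" x N] assms by simp
  then show ?thesis by (simp only: of_real_eq_1_iff)
qed

lemma integrable_fejer_mean: "integrable circle (fejer_mean N f)"
  unfolding fejer_mean_def[abs_def]
  by (intro integrable_divide_zero Bochner_Integration.integrable_sum integrable_mult_right integrable_powi)

text \<open>The mean averages \<open>f\<close> against a nonnegative kernel of mass 1. The bound
  holds at every point of the circle and uniformly in N, as needed for the dominated convergence in
  \<open>invariant_bounded_mult\<close>.\<close>

lemma norm_fejer_mean_le:
  assumes f: "integrable circle f" and B: "AE y in circle. cmod (f y) \<le> B"
    and x: "cmod x = 1" and N: "N > 0"
  shows "cmod (fejer_mean N f x) \<le> B"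
proof -
  have "cmod (fejer_mean N f x) \<le> (LINT y|circle. cmod (f y * complex_of_real (fejer_kernel N x y)))"
    unfolding fejer_mean_eq_integral[OF f x] by (rule integral_norm_bound)
  also have "\<dots> \<le> (LINT y|circle. B * fejer_kernel N x y)"
  proof (rule integral_mono_AE)
    show "AE y in circle. cmod (f y * complex_of_real (fejer_kernel N x y)) \<le> B * fejer_kernel N x y"
      using B by eventually_elim (simp add: norm_mult fejer_kernel_nonneg mult_right_mono)
  qed (use integrable_mult_fejer_kernel[OF f x] integrable_fejer_kernel[OF x] in auto)
  also have "\<dots> = B" using integral_fejer_kernel[OF x N] by simp
  finally show ?thesis .
qed

text \<open>Tonelli moves the integration over x inside, where the symmetric kernel again has mass
  1.\<close>

lemma fejer_mean_contraction:
  assumes f: "integrable circle f"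
  shows "(LINT x|circle. cmod (fejer_mean N f x)) \<le> (LINT x|circle. cmod (f x))"
proof (cases "N = 0")
  case True
  then show ?thesis by (simp add: fejer_mean_def)
next
  case False
  interpret pair_sigma_finite circle circle ..
  note [measurable] = borel_measurable_integrable[OF f]
  have K: "(\<integral>\<^sup>+y. ennreal (fejer_kernel N x y) \<partial>circle) = 1" if "cmod x = 1" for x
    using integral_fejer_kernel[OF that, of N] False integrable_fejer_kernel[OF that, of N]
    by (subst nn_integral_eq_integral) (auto simp: fejer_kernel_nonneg)
  have "(\<integral>\<^sup>+x. cmod (fejer_mean N f x) \<partial>circle)
      \<le> (\<integral>\<^sup>+x. \<integral>\<^sup>+y. ennreal (cmod (f y)) * ennreal (fejer_kernel N x y) \<partial>circle \<partial>circle)"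
  proof (rule nn_integral_mono)
    fix x assume "x \<in> space circle"
    then have x: "cmod x = 1" by simp
    have [measurable]: "fejer_kernel N x \<in> borel_measurable circle"
      using integrable_fejer_kernel[OF x] by auto
    have "cmod (fejer_mean N f x)
        \<le> (\<integral>\<^sup>+y. cmod (f y * complex_of_real (fejer_kernel N x y)) \<partial>circle)"
      unfolding fejer_mean_eq_integral[OF f x] 
      by (rule integral_norm_bound_ennreal[OF integrable_mult_fejer_kernel[OF f x]])
    also have "\<dots> = (\<integral>\<^sup>+y. ennreal (cmod (f y)) * ennreal (fejer_kernel N x y) \<partial>circle)"
      by (intro nn_integral_cong)
        (simp add: norm_mult fejer_kernel_nonneg ennreal_mult)
    finally show "ennreal (cmod (fejer_mean N f x))
        \<le> (\<integral>\<^sup>+y. ennreal (cmod (f y)) * ennreal (fejer_kernel N x y) \<partial>circle)" .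
  qed
  also have "\<dots> = (\<integral>\<^sup>+y. \<integral>\<^sup>+x. ennreal (cmod (f y)) * ennreal (fejer_kernel N x y) \<partial>circle \<partial>circle)"
    by (rule Fubini'[symmetric]) (simp add: split_beta', measurable)
  also have "\<dots> = (\<integral>\<^sup>+y. ennreal (cmod (f y)) \<partial>circle)"
  proof (rule nn_integral_cong)
    fix y assume "y \<in> space circle"
    then have y: "cmod y = 1" by simp
    have m: "fejer_kernel N y \<in> borel_measurable circle"
      using integrable_fejer_kernel[OF y] by auto
    show "(\<integral>\<^sup>+x. ennreal (cmod (f y)) * ennreal (fejer_kernel N x y) \<partial>circle) = ennreal (cmod (f y))"
      by (subst fejer_kernel_commute, subst nn_integral_cmult) (use m K[OF y] in auto)
  qed
  finally have "(\<integral>\<^sup>+x. cmod (fejer_mean N f x) \<partial>circle) \<le> (\<integral>\<^sup>+y. ennreal (cmod (f y)) \<partial>circle)" .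
  then show ?thesis
    using f integrable_fejer_mean[of N f]
    by (simp add: nn_integral_eq_integral)
qed

text \<open>For a character the mean multiplies by a number within |m|/N of 1. The contraction
  property makes the set of good functions closed in L1, and density of the characters does the
  rest.\<close>

lemma fejer_mean_tendsto_L1:
  assumes "integrable circle f"
  shows "(\<lambda>N. LINT z|circle. cmod (fejer_mean N f z - f z)) \<longlonglongrightarrow> 0"
  using assms
proof (induction rule: circle_L1_induct)
  case (add f g)
  note [simp] = add.hyps integrable_fejer_mean
  have "(\<lambda>N. (LINT z|circle. cmod (fejer_mean N f z - f z))
      + (LINT z|circle. cmod (fejer_mean N g z - g z))) \<longlonglongrightarrow> 0"
    using tendsto_add[OF add.IH] by simp
  then show ?case
  proof (rule Lim_null_comparison[rotated], intro always_eventually allI)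
    fix N
    have "fejer_mean N (\<lambda>z. f z + g z) z = fejer_mean N f z + fejer_mean N g z" for z
      by (simp add: fejer_mean_def fourier_coeff_add distrib_right sum.distrib add_divide_distrib)
    then have "(LINT z|circle. cmod (fejer_mean N (\<lambda>z. f z + g z) z - (f z + g z)))
        \<le> (LINT z|circle. cmod (fejer_mean N f z - f z) + cmod (fejer_mean N g z - g z))"
      by (intro integral_mono_AE AE_I2) (auto intro: norm_diff_triangle_ineq)
    then show "norm (LINT z|circle. cmod (fejer_mean N (\<lambda>z. f z + g z) z - (f z + g z)))
        \<le> (LINT z|circle. cmod (fejer_mean N f z - f z)) + (LINT z|circle. cmod (fejer_mean N g z - g z))"
      by simp
  qed
next
  case (scale c f)
  have "fejer_mean N (\<lambda>z. c * f z) z - c * f z = c * (fejer_mean N f z - f z)" for N z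
    by (simp add: fejer_mean_def fourier_coeff_cmult scale.hyps sum_distrib_left right_diff_distrib mult.assoc)
  then show ?case
    using tendsto_mult_right_zero[OF scale.IH, of "cmod c"] by (simp add: norm_mult)
next
  case (powi m)
  have bound: "cmod (fejer_mean N (\<lambda>z. z powi m) z - z powi m) \<le> \<bar>real_of_int m\<bar> / real N"
    if z: "cmod z = 1" and N: "N > nat \<bar>m\<bar>" for N z
  proof -
    \<comment> \<open>The number of i < N for which the partner j = i - m also lies below N, that
      is, how often the index m occurs in the double sum.\<close>
    define c where "c = card {i. i < N \<and> m \<le> int i \<and> int i < int N + m}"
    have "(\<Sum>j<N. if m = int i - int j then z powi m else 0)
        = (if m \<le> int i \<and> int i < int N + m then z powi m else 0)" for i
    proof -
      have "(\<Sum>j<N. if m = int i - int j then z powi m else 0)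
          = (\<Sum>j<N. if j = nat (int i - m) \<and> m \<le> int i then z powi m else 0)"
        by (intro sum.cong refl if_cong) auto
      also have "\<dots> = (if m \<le> int i \<and> int i < int N + m then z powi m else 0)"
        by (cases "m \<le> int i") (auto simp: sum.delta)
      finally show ?thesis .
    qed
    then have "(\<Sum>i<N. \<Sum>j<N. if m = int i - int j then z powi m else 0) = of_nat c * z powi m"
      by (simp add: c_def flip: sum.inter_filter)
    moreover have "fejer_mean N (\<lambda>z. z powi m) z
        = (\<Sum>i<N. \<Sum>j<N. if m = int i - int j then z powi m else 0) / of_nat N"
      unfolding fejer_mean_def fourier_coeff_powi
      by (intro arg_cong2[where f = "(/)"] sum.cong refl) auto
    ultimately have "fejer_mean N (\<lambda>z. z powi m) z - z powi m = of_real (real c / real N - 1) * z powi m"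
      by (simp add: algebra_simps)
    then have "cmod (fejer_mean N (\<lambda>z. z powi m) z - z powi m) = \<bar>real c / real N - 1\<bar>"
      using z by (simp add: norm_mult norm_powi_circle del: of_real_diff of_real_divide)
    moreover have cN: "c \<le> N"
      unfolding c_def using card_mono[of "{..<N}" "{i. i < N \<and> m \<le> int i \<and> int i < int N + m}"] by auto
    \<comment> \<open>An i that is not counted lies below m or from N + m upwards. According to the
      sign of m only one of these ranges is nonempty, and it has at most |m| elements.\<close>
    moreover have "N \<le> c + nat \<bar>m\<bar>"
    proof -
      have "{..<N} \<subseteq> {i. i < N \<and> m \<le> int i \<and> int i < int N + m} \<union> {..<nat m} \<union> {nat (int N + m)..<N}"
        by auto
      then have "card {..<N} \<le> card ({i. i < N \<and> m \<le> int i \<and> int i < int N + m} \<union> {..<nat m} \<union> {nat (int N + m)..<N})"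
        by (intro card_mono) auto
      also have "\<dots> \<le> c + nat m + card {nat (int N + m)..<N}"
        unfolding c_def by (intro order_trans[OF card_Un_le] add_mono order_refl) auto
      finally show ?thesis using N by simp
    qed
    then have "(real N - real c) / real N \<le> \<bar>real_of_int m\<bar> / real N"
      by (intro divide_right_mono) linarith+
    moreover have "\<bar>real c / real N - 1\<bar> = (real N - real c) / real N"
      using cN N by (auto simp: field_simps)
    ultimately show ?thesis by simp
  qed
  have "(\<lambda>N. \<bar>real_of_int m\<bar> / real N) \<longlonglongrightarrow> 0"
    by (rule lim_const_over_n)
  then show ?case
  proof (rule Lim_null_comparison[rotated])
    show "\<forall>\<^sub>F N in sequentially.
        norm (LINT z|circle. cmod (fejer_mean N (\<lambda>z. z powi m) z - z powi m)) \<le> \<bar>real_of_int m\<bar> / real N"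
      using eventually_gt_at_top[of "nat \<bar>m\<bar>"]
    proof eventually_elim
      case (elim N)
      have "(LINT z|circle. cmod (fejer_mean N (\<lambda>z. z powi m) z - z powi m))
          \<le> (LINT z|circle. \<bar>real_of_int m\<bar> / real N)"
        using bound[OF _ elim]
        by (intro integral_mono_AE AE_I2) (auto simp: integrable_fejer_mean integrable_powi)
      then show ?case by simp
    qed
  qed
next
  case (closed f)
  note [simp] = closed(1) integrable_fejer_mean
  show ?case
  proof (rule tendstoI)
    fix e :: real assume e: "e > 0"
    obtain g where g [simp]: "integrable circle g"
      and lim: "(\<lambda>N. LINT z|circle. cmod (fejer_mean N g z - g z)) \<longlonglongrightarrow> 0"
      and fg: "(LINT z|circle. cmod (f z - g z)) < e / 3"
      using closed(2)[of "e / 3"] e by auto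
    have "\<forall>\<^sub>F N in sequentially. (LINT z|circle. cmod (fejer_mean N g z - g z)) < e / 3"
      using order_tendstoD(2)[OF lim, of "e / 3"] e by simp
    then show "\<forall>\<^sub>F N in sequentially. dist (LINT z|circle. cmod (fejer_mean N f z - f z)) 0 < e"
    proof eventually_elim
      case (elim N)
      \<comment> \<open>Three-term estimate: the mean of f - g is controlled by the contraction,
        uniformly in N, so \<open>g\<close> can be fixed before N.\<close>
      have lin: "fejer_mean N f z = fejer_mean N g z + fejer_mean N (\<lambda>z. f z - g z) z" for z
        by (simp add: fejer_mean_def fourier_coeff_diff left_diff_distrib sum_subtractf diff_divide_distrib)
      have "(LINT z|circle. cmod (fejer_mean N f z - f z))
          \<le> (LINT z|circle. cmod (fejer_mean N (\<lambda>z. f z - g z) z) + cmod (fejer_mean N g z - g z) + cmod (f z - g z))"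
      proof (intro integral_mono_AE AE_I2)
        fix z
        have *: "fejer_mean N f z - f z = fejer_mean N (\<lambda>z. f z - g z) z + (fejer_mean N g z - g z) - (f z - g z)"
          by (simp add: lin)
        show "cmod (fejer_mean N f z - f z)
          \<le> cmod (fejer_mean N (\<lambda>z. f z - g z) z) + cmod (fejer_mean N g z - g z) + cmod (f z - g z)"
          unfolding *
          using norm_triangle_ineq4[of "fejer_mean N (\<lambda>z. f z - g z) z + (fejer_mean N g z - g z)" "f z - g z"]
            norm_triangle_ineq[of "fejer_mean N (\<lambda>z. f z - g z) z" "fejer_mean N g z - g z"]
          by linarith
      qed auto
      also have "\<dots> = (LINT z|circle. cmod (fejer_mean N (\<lambda>z. f z - g z) z))
          + (LINT z|circle. cmod (fejer_mean N g z - g z)) + (LINT z|circle. cmod (f z - g z))"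
        by simp
      also have "\<dots> < e"
        using fejer_mean_contraction[of "\<lambda>z. f z - g z" N] elim fg by simp
      finally show ?case by simp
    qed
  qed
qed

text \<open>All Fejer means of \<open>f\<close> vanish identically, yet they converge to
  \<open>f\<close> in L1.\<close>

lemma fourier_coeff_unique:
  assumes f: "integrable circle f" and "\<And>n. fourier_coeff f n = 0"
  shows "AE z in circle. f z = 0"
proof -
  have "(\<lambda>N. LINT z|circle. cmod (fejer_mean N f z - f z)) = (\<lambda>_. LINT z|circle. cmod (f z))"
    by (simp add: fejer_mean_def assms)
  with fejer_mean_tendsto_L1[OF f] have "(LINT z|circle. cmod (f z)) = 0"
    by (simp add: LIMSEQ_const_iff)
  then show ?thesis
    using f by (simp add: integral_nonneg_eq_0_iff_AE)
qed

section \<open>Real Fourier coefficients\<close>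

lemma fourier_coeff_cnj:
  assumes "integrable circle f"
  shows "fourier_coeff (\<lambda>z. cnj (f (cnj z))) n = cnj (fourier_coeff f n)"
proof -
  have m: "(\<lambda>z. f z * z powi (- n)) \<in> borel_measurable circle"
    using assms by measurable
  have "(LINT z|circle. cnj (f (cnj z)) * z powi (- n)) = (LINT z|circle. cnj (f (cnj z) * cnj z powi (- n)))"
    by simp
  also have "\<dots> = cnj (LINT z|circle. f (cnj z) * cnj z powi (- n))"
    by (rule Bochner_Integration.integral_cnj)
  also have "\<dots> = cnj (LINT z|circle. f z * z powi (- n))"
    using integral_circle_cnj[OF m] by simp
  finally show ?thesis
    using fourier_coeff_eq[OF borel_measurable_integrable[OF assms]]
      fourier_coeff_eq[OF borel_measurable_integrable[OF integrable_cnj[OF integrable_circle_cnj[OF assms]]]]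
    by simp
qed

text \<open>Unlike the condition on coefficients, this one passes through products and conjugates at
  once and also makes sense without integrability.\<close>

definition real_symmetric :: "(complex \<Rightarrow> complex) \<Rightarrow> bool" where
  "real_symmetric f \<longleftrightarrow> (AE z in circle. f (cnj z) = cnj (f z))"

text \<open>The involution taking f to \<open>cnj (f (cnj z))\<close> conjugates every coefficient,
  so by uniqueness the coefficients are real exactly when it fixes f almost everywhere.\<close>

lemma RL1_iff: "f \<in> RL1 \<longleftrightarrow> integrable circle f \<and> real_symmetric f"
proof (cases "integrable circle f")
  case f: True
  have i: "integrable circle (\<lambda>z. cnj (f (cnj z)))"
    by (intro integrable_cnj integrable_circle_cnj f)
  have "f \<in> RL1 \<longleftrightarrow> (\<forall>n. cnj (fourier_coeff f n) = fourier_coeff f n)"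
    using f by (auto simp: RL1_def L1_def Reals_cnj_iff)
  also have "\<dots> \<longleftrightarrow> (AE z in circle. cnj (f (cnj z)) = f z)"
  proof
    assume "\<forall>n. cnj (fourier_coeff f n) = fourier_coeff f n"
    then have "AE z in circle. cnj (f (cnj z)) - f z = 0"
      using i f by (intro fourier_coeff_unique) (auto simp: fourier_coeff_diff fourier_coeff_cnj)
    then show "AE z in circle. cnj (f (cnj z)) = f z" by simp
  next
    assume *: "AE z in circle. cnj (f (cnj z)) = f z"
    then show "\<forall>n. cnj (fourier_coeff f n) = fourier_coeff f n"
      using fourier_coeff_cong_AE[of "\<lambda>z. cnj (f (cnj z))" f] i f by (auto simp: fourier_coeff_cnj)
  qed
  also have "\<dots> \<longleftrightarrow> real_symmetric f"
    unfolding real_symmetric_def by (intro AE_cong) (metis complex_cnj_cnj)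
  finally show ?thesis using f by simp
qed (simp add: RL1_def L1_def)

lemma real_symmetric_diff:
  assumes "real_symmetric f" "real_symmetric g"
  shows "real_symmetric (\<lambda>z. f z - g z)"
  using assms unfolding real_symmetric_def by eventually_elim simp

lemma real_symmetric_mult:
  assumes "real_symmetric f" "real_symmetric g"
  shows "real_symmetric (\<lambda>z. f z * g z)"
  using assms unfolding real_symmetric_def by eventually_elim simp

lemma real_symmetric_cnj:
  assumes "real_symmetric f"
  shows "real_symmetric (\<lambda>z. cnj (f z))"
  using assms unfolding real_symmetric_def by eventually_elim simp

lemma real_symmetric_powi: "real_symmetric (\<lambda>z. z powi n)"
  unfolding real_symmetric_def by simp

lemma real_symmetric_cong_AE:
  assumes "real_symmetric f" "AE z in circle. f z = g z"
  shows "real_symmetric g"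
  using assms(1) assms(2) AE_circle_cnj[OF assms(2)]
  unfolding real_symmetric_def by eventually_elim simp

lemma integral_real_symmetric:
  assumes "integrable circle f" "real_symmetric f"
  shows "(LINT z|circle. f z) \<in> \<real>"
proof -
  have "f \<in> RL1" using assms by (simp add: RL1_iff)
  then have "fourier_coeff f 0 \<in> \<real>" by (simp add: RL1_def)
  then show ?thesis using assms by (simp add: fourier_coeff_eq)
qed

section \<open>Orthogonal projection of square integrable functions\<close>

definition square_integrable :: "'a measure \<Rightarrow> ('a \<Rightarrow> 'b::real_normed_vector) \<Rightarrow> bool" where
  "square_integrable M f \<longleftrightarrow> f \<in> borel_measurable M \<and> integrable M (\<lambda>x. (norm (f x))\<^sup>2)"

lemma square_integrable_measurable [measurable_dest]:
  "square_integrable M f \<Longrightarrow> f \<in> borel_measurable M"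
  by (simp add: square_integrable_def)

lemma square_integrable_add:
  fixes f g :: "'a \<Rightarrow> 'b::{real_normed_vector, second_countable_topology}"
  assumes "square_integrable M f" "square_integrable M g"
  shows "square_integrable M (\<lambda>x. f x + g x)"
  unfolding square_integrable_def
proof (intro conjI)
  have [measurable]: "f \<in> borel_measurable M" "g \<in> borel_measurable M"
    using assms by (auto simp: square_integrable_def)
  show "(\<lambda>x. f x + g x) \<in> borel_measurable M" by measurable
  have "integrable M (\<lambda>x. 2 * (norm (f x))\<^sup>2 + 2 * (norm (g x))\<^sup>2)"
    using assms by (auto simp: square_integrable_def)
  then show "integrable M (\<lambda>x. (norm (f x + g x))\<^sup>2)"
  proof (rule Bochner_Integration.integrable_bound)
    have "(norm (f x + g x))\<^sup>2 \<le> 2 * (norm (f x))\<^sup>2 + 2 * (norm (g x))\<^sup>2" for x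
    proof -
      have "(norm (f x + g x))\<^sup>2 \<le> (norm (f x) + norm (g x))\<^sup>2"
        by (intro power_mono norm_triangle_ineq) simp
      also have "\<dots> \<le> 2 * (norm (f x))\<^sup>2 + 2 * (norm (g x))\<^sup>2"
        using sum_squares_bound[of "norm (f x)" "norm (g x)"] by (simp add: power2_sum)
      finally show ?thesis .
    qed
    then show "AE x in M. norm ((norm (f x + g x))\<^sup>2) \<le> norm (2 * (norm (f x))\<^sup>2 + 2 * (norm (g x))\<^sup>2)"
      by (intro AE_I2) simp
  qed measurable
qed

lemma square_integrable_scaleR:
  fixes f :: "'a \<Rightarrow> 'b::{real_normed_vector, second_countable_topology}"
  assumes "square_integrable M f"
  shows "square_integrable M (\<lambda>x. c *\<^sub>R f x)"
  using assms by (auto simp: square_integrable_def power_mult_distrib)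

lemma square_integrable_diff:
  fixes f g :: "'a \<Rightarrow> 'b::{real_normed_vector, second_countable_topology}"
  assumes "square_integrable M f" "square_integrable M g"
  shows "square_integrable M (\<lambda>x. f x - g x)"
  using square_integrable_add[OF assms(1) square_integrable_scaleR[OF assms(2), of "-1"]] by simp

lemma square_integrable_norm_mult:
  assumes f: "square_integrable M f" and g: "square_integrable M g"
  shows "integrable M (\<lambda>x. norm (f x) * norm (g x))"
proof (rule Bochner_Integration.integrable_bound)
  show "integrable M (\<lambda>x. (norm (f x))\<^sup>2 + (norm (g x))\<^sup>2)"
    using assms by (auto simp: square_integrable_def)
  have "norm (f x) * norm (g x) \<le> (norm (f x))\<^sup>2 + (norm (g x))\<^sup>2" for x
    using sum_squares_bound[of "norm (f x)" "norm (g x)"]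
      mult_nonneg_nonneg[OF norm_ge_zero[of "f x"] norm_ge_zero[of "g x"]]
    unfolding mult.assoc by linarith
  then show "AE x in M. norm (norm (f x) * norm (g x)) \<le> norm ((norm (f x))\<^sup>2 + (norm (g x))\<^sup>2)"
    by (intro AE_I2) simp
qed (use assms in measurable)

lemma square_integrable_inner:
  fixes f g :: "'a \<Rightarrow> 'b::{real_inner, second_countable_topology}"
  assumes "square_integrable M f" "square_integrable M g"
  shows "integrable M (\<lambda>x. inner (f x) (g x))"
  by (rule Bochner_Integration.integrable_bound[OF square_integrable_norm_mult[OF assms]])
    (use assms in \<open>auto intro: Cauchy_Schwarz_ineq2\<close>)

lemma integral_norm_mult_le:
  fixes f g :: "'a \<Rightarrow> 'b::{real_normed_vector, second_countable_topology}"
  assumes f: "square_integrable M f" and g: "square_integrable M g"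
  shows "(LINT x|M. norm (f x) * norm (g x))\<^sup>2 \<le> (LINT x|M. (norm (f x))\<^sup>2) * (LINT x|M. (norm (g x))\<^sup>2)"
proof -
  have [measurable]: "f \<in> borel_measurable M" "g \<in> borel_measurable M"
    using assms by (auto simp: square_integrable_def)
  have "ennreal ((LINT x|M. norm (f x) * norm (g x))\<^sup>2)
      = (\<integral>\<^sup>+x. ennreal (norm (f x)) * ennreal (norm (g x)) \<partial>M)\<^sup>2"
    using square_integrable_norm_mult[OF assms]
    by (simp add: nn_integral_eq_integral ennreal_power flip: ennreal_mult)
  also have "\<dots> \<le> (\<integral>\<^sup>+x. (ennreal (norm (f x)))\<^sup>2 \<partial>M) * (\<integral>\<^sup>+x. (ennreal (norm (g x)))\<^sup>2 \<partial>M)"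
    by (rule Cauchy_Schwarz_nn_integral) measurable
  also have "\<dots> = ennreal ((LINT x|M. (norm (f x))\<^sup>2) * (LINT x|M. (norm (g x))\<^sup>2))"
    using assms by (simp add: nn_integral_eq_integral ennreal_power square_integrable_def ennreal_mult)
  finally show ?thesis
    by (subst (asm) ennreal_le_iff) auto
qed

lemma integral_inner_le:
  fixes f g :: "'a \<Rightarrow> 'b::{real_inner, second_countable_topology}"
  assumes "square_integrable M f" "square_integrable M g"
  shows "(LINT x|M. inner (f x) (g x))\<^sup>2 \<le> (LINT x|M. (norm (f x))\<^sup>2) * (LINT x|M. (norm (g x))\<^sup>2)"
proof -
  have "\<bar>LINT x|M. inner (f x) (g x)\<bar> \<le> (LINT x|M. \<bar>inner (f x) (g x)\<bar>)"
    by (rule integral_abs_bound)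
  also have "\<dots> \<le> (LINT x|M. norm (f x) * norm (g x))"
    by (intro integral_mono_AE AE_I2 Cauchy_Schwarz_ineq2 square_integrable_norm_mult assms
        integrable_abs square_integrable_inner)
  finally have "(LINT x|M. inner (f x) (g x))\<^sup>2 \<le> (LINT x|M. norm (f x) * norm (g x))\<^sup>2"
    by (metis abs_ge_zero power2_abs power_mono)
  then show ?thesis
    using integral_norm_mult_le[OF assms] by linarith
qed

lemma (in finite_measure) square_integrable_const: "square_integrable M (\<lambda>_. c)"
  by (simp add: square_integrable_def)

text \<open>Cauchy-Schwarz against the constant 1. It carries L2 approximation over to the L1 norm,
  in which \<open>M\<close> is closed.\<close>

lemma (in finite_measure) integral_norm_le_square:
  fixes f :: "'a \<Rightarrow> 'b::{banach, second_countable_topology}"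
  assumes "square_integrable M f"
  shows "integrable M f"
    and "(LINT x|M. norm (f x))\<^sup>2 \<le> (LINT x|M. (norm (f x))\<^sup>2) * measure M (space M)"
proof -
  have [measurable]: "f \<in> borel_measurable M" using assms by measurable
  have i: "square_integrable M (\<lambda>x. norm (f x))"
    using assms by (auto simp: square_integrable_def)
  from square_integrable_norm_mult[OF i square_integrable_const[of "1::real"]]
  show "integrable M f" by (simp add: integrable_norm_iff)
  show "(LINT x|M. norm (f x))\<^sup>2 \<le> (LINT x|M. (norm (f x))\<^sup>2) * measure M (space M)"
    using integral_norm_mult_le[OF i square_integrable_const[of "1::real"]] by simp
qed

lemma integral_norm_diff_scaleR:
  fixes f g :: "'a \<Rightarrow> 'b::{real_inner, second_countable_topology}"
  assumes "square_integrable M f" "square_integrable M g"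
  shows "(LINT x|M. (norm (f x - t *\<^sub>R g x))\<^sup>2)
    = (LINT x|M. (norm (f x))\<^sup>2) - 2 * t * (LINT x|M. inner (f x) (g x)) + t\<^sup>2 * (LINT x|M. (norm (g x))\<^sup>2)"
proof -
  have "(norm (f x - t *\<^sub>R g x))\<^sup>2 = (norm (f x))\<^sup>2 - 2 * t * inner (f x) (g x) + t\<^sup>2 * (norm (g x))\<^sup>2" for x
    unfolding power2_norm_eq_inner
    by (simp add: inner_diff_left inner_diff_right inner_commute algebra_simps power2_eq_square)
  then show ?thesis
    using assms square_integrable_inner[OF assms] by (simp add: square_integrable_def)
qed

text \<open>The nearest-point argument for a real-linear space of functions. \<open>N\<close> is not
  assumed closed, so the projection \<open>h\<close> is only approximated by elements of
  \<open>N\<close>; it is built from a minimising sequence.\<close>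

lemma (in finite_measure) square_integrable_projection:
  fixes N :: "('a \<Rightarrow> 'b::{real_inner, banach, second_countable_topology}) set"
  assumes N: "\<And>u. u \<in> N \<Longrightarrow> square_integrable M u"
    and zero: "(\<lambda>_. 0) \<in> N"
    and add: "\<And>u v. u \<in> N \<Longrightarrow> v \<in> N \<Longrightarrow> (\<lambda>x. u x + v x) \<in> N"
    and scale: "\<And>c u. u \<in> N \<Longrightarrow> (\<lambda>x. c *\<^sub>R u x) \<in> N"
    and g: "square_integrable M g"
  obtains h where "square_integrable M h"
    and "\<And>e. e > 0 \<Longrightarrow> \<exists>u\<in>N. (LINT x|M. (norm (h x - u x))\<^sup>2) < e"
    and "\<And>u. u \<in> N \<Longrightarrow> (LINT x|M. inner (g x - h x) (u x)) = 0"
proof -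
  define d where "d = (INF u\<in>N. LINT x|M. (norm (g x - u x))\<^sup>2)"
  have bdd: "bdd_below ((\<lambda>u. LINT x|M. (norm (g x - u x))\<^sup>2) ` N)"
    by (rule bdd_belowI2[of _ 0]) simp
  have d_le: "d \<le> (LINT x|M. (norm (g x - u x))\<^sup>2)" if "u \<in> N" for u
    unfolding d_def by (rule cINF_lower[OF bdd that])
  define \<delta> where "\<delta> n = 1 / real (Suc n)" for n
  have \<delta>_pos: "\<delta> n > 0" for n by (simp add: \<delta>_def)
  have \<delta>_lim: "\<delta> \<longlonglongrightarrow> 0" unfolding \<delta>_def[abs_def] by (rule LIMSEQ_Suc[OF lim_1_over_n])
  have \<delta>_anti: "\<delta> n \<le> \<delta> m" if "m \<le> n" for m n
    using that by (simp add: \<delta>_def frac_le)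
  have "\<exists>u\<in>N. (LINT x|M. (norm (g x - u x))\<^sup>2) < d + \<delta> n" for n
    using cINF_less_iff[of N "\<lambda>u. LINT x|M. (norm (g x - u x))\<^sup>2" "d + \<delta> n"] zero bdd \<delta>_pos[of n]
    unfolding d_def[symmetric] by auto
  then obtain u where uN: "\<And>n. u n \<in> N" and u: "\<And>n. (LINT x|M. (norm (g x - u n x))\<^sup>2) < d + \<delta> n"
    by metis
  have usq: "square_integrable M (u n)" for n by (rule N[OF uN])
  have [measurable]: "u n \<in> borel_measurable M" for n using usq by measurable
  have close: "(LINT x|M. (norm (u i x - u j x))\<^sup>2) \<le> 2 * \<delta> i + 2 * \<delta> j" for i j
  proof -
    \<comment> \<open>The midpoint lies in \<open>N\<close>, so its distance to \<open>g\<close> is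
      at least the infimum. The parallelogram law then bounds the distance between two nearly
      optimal elements.\<close>
    define w where "w x = (1/2) *\<^sub>R (u i x + u j x)" for x
    have wN: "w \<in> N" unfolding w_def[abs_def] by (intro scale add uN)
    have "(norm (u i x - u j x))\<^sup>2
        = 2 * (norm (g x - u i x))\<^sup>2 + 2 * (norm (g x - u j x))\<^sup>2 - 4 * (norm (g x - w x))\<^sup>2" for x
      unfolding power2_norm_eq_inner w_def
      by (simp add: inner_diff_left inner_diff_right inner_add_left inner_add_right inner_commute algebra_simps)
    then have "(LINT x|M. (norm (u i x - u j x))\<^sup>2)
        = 2 * (LINT x|M. (norm (g x - u i x))\<^sup>2) + 2 * (LINT x|M. (norm (g x - u j x))\<^sup>2)
          - 4 * (LINT x|M. (norm (g x - w x))\<^sup>2)"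
      using square_integrable_diff[OF g usq[of i]] square_integrable_diff[OF g usq[of j]]
        square_integrable_diff[OF g N[OF wN]]
      by (simp add: square_integrable_def)
    then show ?thesis using u[of i] u[of j] d_le[OF wN] by linarith
  qed
  \<comment> \<open>Being Cauchy in L2 is weakened to being Cauchy in L1, from which an almost
    everywhere Cauchy subsequence can be drawn. The constant c exceeds the total mass by 1 to be
    positive in every case, and 4 comes from \<open>close\<close> with both indices at least
    n0.\<close>
  have "\<exists>n0. \<forall>i\<ge>n0. \<forall>j\<ge>n0. (LINT x|M. norm (u i x - u j x)) < e" if e: "e > 0" for e
  proof -
    define c where "c = measure M (space M) + 1"
    have c: "c > 0" unfolding c_def using measure_nonneg[of M "space M"] by linarith
    obtain n0 where n0: "\<delta> n0 < e\<^sup>2 / (4 * c)"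
      using order_tendstoD(2)[OF \<delta>_lim, of "e\<^sup>2 / (4 * c)"] e c
      by (auto simp: eventually_sequentially)
    have "(LINT x|M. norm (u i x - u j x)) < e" if ij: "i \<ge> n0" "j \<ge> n0" for i j
    proof -
      have "(LINT x|M. norm (u i x - u j x))\<^sup>2 \<le> (LINT x|M. (norm (u i x - u j x))\<^sup>2) * measure M (space M)"
        by (intro integral_norm_le_square square_integrable_diff usq)
      also have "\<dots> \<le> (4 * \<delta> n0) * c"
        using close[of i j] \<delta>_anti[OF ij(1)] \<delta>_anti[OF ij(2)]
        by (intro mult_mono) (auto simp: c_def less_imp_le[OF \<delta>_pos])
      also have "\<dots> < e\<^sup>2" using n0 c by (simp add: field_simps)
      finally show ?thesis using e by (intro power_less_imp_less_base[of _ 2 e]) auto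
    qed
    then show ?thesis by blast
  qed
  then obtain r where r: "strict_mono r" and cauchy: "AE x in M. Cauchy (\<lambda>i. u (r i) x)"
    using cauchy_L1_AE_cauchy_subseq[of M u] integral_norm_le_square(1)[OF usq] by blast
  define h where "h x = lim (\<lambda>i. u (r i) x)" for x
  have [measurable]: "h \<in> borel_measurable M" unfolding h_def[abs_def] by measurable
  have h: "AE x in M. (\<lambda>i. u (r i) x) \<longlonglongrightarrow> h x"
    using cauchy by eventually_elim (simp add: h_def Cauchy_convergent_iff convergent_LIMSEQ_iff)
  \<comment> \<open>Fatou's lemma along an almost everywhere convergent subsequence replaces completeness of \<open>L\<^sup>2\<close>.\<close>
  have fatou: "(\<integral>\<^sup>+x. ennreal ((norm (h x - u n x))\<^sup>2) \<partial>M) \<le> ennreal (4 * \<delta> n)" for n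
  proof -
    have "(\<integral>\<^sup>+x. ennreal ((norm (h x - u n x))\<^sup>2) \<partial>M)
        = (\<integral>\<^sup>+x. liminf (\<lambda>i. ennreal ((norm (u (r i) x - u n x))\<^sup>2)) \<partial>M)"
    proof (rule nn_integral_cong_AE, use h in eventually_elim)
      case (elim x)
      then have "(\<lambda>i. ennreal ((norm (u (r i) x - u n x))\<^sup>2)) \<longlonglongrightarrow> ennreal ((norm (h x - u n x))\<^sup>2)"
        by (intro tendsto_ennrealI tendsto_intros)
      then show ?case by (rule lim_imp_Liminf[OF sequentially_bot, symmetric])
    qed
    also have "\<dots> \<le> liminf (\<lambda>i. \<integral>\<^sup>+x. ennreal ((norm (u (r i) x - u n x))\<^sup>2) \<partial>M)"
      by (rule nn_integral_liminf) measurable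
    also have "\<dots> \<le> liminf (\<lambda>i::nat. ennreal (4 * \<delta> n))"
    proof (rule Liminf_mono, use eventually_ge_at_top[of n] in eventually_elim)
      case (elim i)
      have "n \<le> r i" using elim seq_suble[OF r, of i] by linarith
      then have "(LINT x|M. (norm (u (r i) x - u n x))\<^sup>2) \<le> 4 * \<delta> n"
        using close[of "r i" n] \<delta>_anti[of n "r i"] by linarith
      moreover have "integrable M (\<lambda>x. (norm (u (r i) x - u n x))\<^sup>2)"
        using square_integrable_diff[OF usq usq] by (simp add: square_integrable_def)
      ultimately show ?case by (simp add: nn_integral_eq_integral ennreal_leI)
    qed
    also have "\<dots> = ennreal (4 * \<delta> n)" by (simp add: Liminf_const)
    finally show ?thesis .
  qed
  have hu: "square_integrable M (\<lambda>x. h x - u n x)" for n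
    unfolding square_integrable_def
  proof (intro conjI integrableI_bounded)
    have "(\<integral>\<^sup>+x. ennreal (norm ((norm (h x - u n x))\<^sup>2)) \<partial>M) \<le> ennreal (4 * \<delta> n)"
      using fatou by simp
    also have "\<dots> < \<infinity>" by simp
    finally show "(\<integral>\<^sup>+x. ennreal (norm ((norm (h x - u n x))\<^sup>2)) \<partial>M) < \<infinity>" .
  qed measurable
  have h_sq: "square_integrable M h"
    using square_integrable_add[OF hu[of 0] usq[of 0]] by simp
  have hu_le: "(LINT x|M. (norm (h x - u n x))\<^sup>2) \<le> 4 * \<delta> n" for n
  proof -
    have "ennreal (LINT x|M. (norm (h x - u n x))\<^sup>2) = (\<integral>\<^sup>+x. ennreal ((norm (h x - u n x))\<^sup>2) \<partial>M)"
      using hu[of n] by (simp add: square_integrable_def nn_integral_eq_integral)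
    with fatou[of n] have "ennreal (LINT x|M. (norm (h x - u n x))\<^sup>2) \<le> ennreal (4 * \<delta> n)"
      by (simp only:)
    moreover have "0 \<le> 4 * \<delta> n" using \<delta>_pos[of n] by simp
    ultimately show ?thesis by (simp only: ennreal_le_iff)
  qed
  show ?thesis
  proof
    show "square_integrable M h" by (rule h_sq)
    show "\<exists>u\<in>N. (LINT x|M. (norm (h x - u x))\<^sup>2) < e" if "e > 0" for e
    proof -
      have "\<forall>\<^sub>F n in sequentially. \<delta> n < e / 4"
        using that by (intro order_tendstoD(2)[OF \<delta>_lim]) simp
      from eventually_happens'[OF sequentially_bot this] obtain n where "\<delta> n < e / 4" ..
      with hu_le[of n] show ?thesis by (intro bexI[OF _ uN[of n]]) linarith
    qed
    fix v assume v: "v \<in> N"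
    define B where "B = (LINT x|M. inner (g x - h x) (v x))"
    define C where "C = (LINT x|M. (norm (v x))\<^sup>2)"
    define \<epsilon> where "\<epsilon> n = (LINT x|M. inner (h x - u n x) (v x))" for n
    have C: "C \<ge> 0" by (simp add: C_def)
    have \<epsilon>_le: "(\<epsilon> n)\<^sup>2 \<le> 4 * \<delta> n * C" for n
      using integral_inner_le[OF hu[of n] N[OF v]] mult_right_mono[OF hu_le[of n] C]
      unfolding \<epsilon>_def C_def by linarith
    have "(\<lambda>n. (\<epsilon> n)\<^sup>2) \<longlonglongrightarrow> 0"
    proof (rule Lim_null_comparison)
      show "\<forall>\<^sub>F n in sequentially. norm ((\<epsilon> n)\<^sup>2) \<le> 4 * \<delta> n * C"
        using \<epsilon>_le by simp
      show "(\<lambda>n. 4 * \<delta> n * C) \<longlonglongrightarrow> 0"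
        using tendsto_mult[OF tendsto_mult[OF tendsto_const[of 4] \<delta>_lim] tendsto_const[of C]] by simp
    qed
    then have \<epsilon>_lim: "\<epsilon> \<longlonglongrightarrow> 0"
      by (rule power_tendsto_0_iff[THEN iffD1, rotated]) simp
    \<comment> \<open>Moving \<open>u n\<close> by a multiple of v cannot beat the infimum. As
      \<open>h\<close> itself need not lie in \<open>N\<close>, the variation is carried out at
      \<open>u n\<close>, with \<open>\<epsilon> n\<close> measuring the difference.\<close>
    have main: "0 \<le> \<delta> n - 2 * t * (B + \<epsilon> n) + t\<^sup>2 * C" for n t
    proof -
      have wN: "(\<lambda>x. u n x + t *\<^sub>R v x) \<in> N" by (intro add scale uN v)
      have gu: "square_integrable M (\<lambda>x. g x - u n x)" by (intro square_integrable_diff g usq)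
      have gh: "square_integrable M (\<lambda>x. g x - h x)" by (intro square_integrable_diff g h_sq)
      have "(LINT x|M. inner (g x - h x) (v x) + inner (h x - u n x) (v x)) = B + \<epsilon> n"
        unfolding B_def \<epsilon>_def
        by (intro Bochner_Integration.integral_add square_integrable_inner gh hu N v)
      then have "(LINT x|M. inner (g x - u n x) (v x)) = B + \<epsilon> n"
        by (simp add: inner_diff_left)
      then have "(LINT x|M. (norm (g x - u n x - t *\<^sub>R v x))\<^sup>2)
          = (LINT x|M. (norm (g x - u n x))\<^sup>2) - 2 * t * (B + \<epsilon> n) + t\<^sup>2 * C"
        using integral_norm_diff_scaleR[OF gu N[OF v], of t] by (simp add: C_def)
      moreover have "d \<le> (LINT x|M. (norm (g x - u n x - t *\<^sub>R v x))\<^sup>2)"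
        using d_le[OF wN] by (simp add: diff_diff_eq)
      ultimately show ?thesis using u[of n] by linarith
    qed
    have quad: "0 \<le> - 2 * t * B + t\<^sup>2 * C" for t
    proof (rule LIMSEQ_le_const)
      show "(\<lambda>n. \<delta> n - 2 * t * (B + \<epsilon> n) + t\<^sup>2 * C) \<longlonglongrightarrow> - 2 * t * B + t\<^sup>2 * C"
        using tendsto_add[OF tendsto_diff[OF \<delta>_lim tendsto_mult[OF tendsto_const[of "2 * t"]
              tendsto_add[OF tendsto_const[of B] \<epsilon>_lim]]] tendsto_const[of "t\<^sup>2 * C"]]
        by simp
    qed (use main in auto)
    \<comment> \<open>Near the minimiser B / C of the quadratic; the added 1 avoids a zero
      denominator, and the value becomes - t^2 (C + 2), which forces t = 0.\<close>
    define t where "t = B / (C + 1)"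
    have B: "B = t * (C + 1)" using C by (simp add: t_def)
    have "- 2 * t * B + t\<^sup>2 * C = - (t\<^sup>2 * (C + 2))"
      unfolding B power2_eq_square by (simp add: algebra_simps)
    with quad[of t] have "t\<^sup>2 * (C + 2) \<le> 0" by simp
    then have "t = 0" using C by (simp add: mult_le_0_iff)
    then show "(LINT x|M. inner (g x - h x) (v x)) = 0"
      using B by (simp add: B_def)
  qed
qed

section \<open>Wandering vectors\<close>

lemma inner_complex_Re: "inner a b = Re (a * cnj b)"
  by (simp add: inner_complex_def)

lemma integrable_mult_cnj:
  assumes "square_integrable circle f" "square_integrable circle g"
  shows "integrable circle (\<lambda>z. f z * cnj (g z))"
  by (rule Bochner_Integration.integrable_bound[OF square_integrable_norm_mult[OF assms]])
    (use assms in \<open>auto simp: norm_mult square_integrable_def\<close>)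

lemma integral_mult_cnj:
  assumes "square_integrable circle f" "square_integrable circle g" "real_symmetric f" "real_symmetric g"
  shows "(LINT z|circle. f z * cnj (g z)) = complex_of_real (LINT z|circle. inner (f z) (g z))"
proof -
  have "(LINT z|circle. f z * cnj (g z)) \<in> \<real>"
    by (intro integral_real_symmetric integrable_mult_cnj real_symmetric_mult real_symmetric_cnj assms)
  moreover have "Re (LINT z|circle. f z * cnj (g z)) = (LINT z|circle. inner (f z) (g z))"
    using integrable_mult_cnj[OF assms(1,2)] by (simp add: inner_complex_Re del: times_complex.sel)
  ultimately show ?thesis by (metis of_real_Re)
qed

lemma square_integrable_circle_mult:
  assumes "square_integrable circle f" "w \<in> borel_measurable circle" "AE z in circle. cmod (w z) \<le> B"
  shows "square_integrable circle (\<lambda>z. w z * f z)"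
  unfolding square_integrable_def
proof
  have [measurable]: "f \<in> borel_measurable circle" using assms by measurable
  note [measurable] = assms(2)
  show "(\<lambda>z. w z * f z) \<in> borel_measurable circle" by measurable
  have "integrable circle (\<lambda>z. B\<^sup>2 * (cmod (f z))\<^sup>2)"
    using assms by (simp add: square_integrable_def)
  then show "integrable circle (\<lambda>z. (cmod (w z * f z))\<^sup>2)"
  proof (rule Bochner_Integration.integrable_bound)
    show "AE z in circle. norm ((cmod (w z * f z))\<^sup>2) \<le> norm (B\<^sup>2 * (cmod (f z))\<^sup>2)"
      using assms(3) by eventually_elim (simp add: norm_mult power_mult_distrib mult_right_mono power_mono)
  qed measurable
qed

lemma L1_norm_le_square:
  assumes "square_integrable circle f"
  shows "(LINT z|circle. cmod (f z))\<^sup>2 \<le> (LINT z|circle. (cmod (f z))\<^sup>2)"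
  using circle.integral_norm_le_square(2)[OF assms] by simp

lemma norm_fourier_coeff_le:
  assumes "integrable circle f"
  shows "cmod (fourier_coeff f n) \<le> L1_norm f"
proof -
  have "cmod (LINT z|circle. f z * z powi (- n)) \<le> (LINT z|circle. cmod (f z * z powi (- n)))"
    by (rule integral_norm_bound)
  also have "\<dots> = (LINT z|circle. cmod (f z))"
    by (intro Bochner_Integration.integral_cong) (auto simp: norm_mult norm_powi_circle)
  finally show ?thesis using assms by (simp add: fourier_coeff_eq L1_norm_def)
qed

text \<open>Each coefficient is a contraction from L1 to the complex numbers, and the reals are
  closed.\<close>

lemma RL1_closed:
  assumes f: "integrable circle f" and approx: "\<And>e. e > 0 \<Longrightarrow> \<exists>g\<in>RL1. L1_norm (\<lambda>z. f z - g z) < e"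
  shows "f \<in> RL1"
proof -
  have "fourier_coeff f n \<in> \<real>" for n
  proof (rule ccontr)
    assume "fourier_coeff f n \<notin> \<real>"
    then have "\<bar>Im (fourier_coeff f n)\<bar> > 0" by (simp add: complex_is_Real_iff)
    then obtain g where g: "g \<in> RL1" "L1_norm (\<lambda>z. f z - g z) < \<bar>Im (fourier_coeff f n)\<bar>"
      using approx by blast
    then have gi: "integrable circle g" and "Im (fourier_coeff g n) = 0"
      by (auto simp: RL1_def L1_def complex_is_Real_iff)
    then have "\<bar>Im (fourier_coeff f n)\<bar> = \<bar>Im (fourier_coeff (\<lambda>z. f z - g z) n)\<bar>"
      using f by (simp add: fourier_coeff_diff)
    also have "\<dots> \<le> cmod (fourier_coeff (\<lambda>z. f z - g z) n)"
      by (rule abs_Im_le_cmod)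
    also have "\<dots> \<le> L1_norm (\<lambda>z. f z - g z)"
      using f gi by (intro norm_fourier_coeff_le) auto
    finally show False using g by simp
  qed
  then show ?thesis using f by (auto simp: RL1_def L1_def)
qed

lemma const_if_fourier_coeff_zero:
  assumes f: "integrable circle f" and zero: "\<And>n. n \<noteq> 0 \<Longrightarrow> fourier_coeff f n = 0"
  shows "AE z in circle. f z = fourier_coeff f 0"
proof -
  have "fourier_coeff (\<lambda>_. 1) n = (if n = 0 then 1 else 0)" for n
    using fourier_coeff_powi[of 0 n] by auto
  then have "fourier_coeff (\<lambda>z. f z - fourier_coeff f 0) n = 0" for n
    using f zero fourier_coeff_cmult[of "\<lambda>_. 1" "fourier_coeff f 0" n]
    by (auto simp: fourier_coeff_diff)
  then have "AE z in circle. f z - fourier_coeff f 0 = 0"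
    using f by (intro fourier_coeff_unique) auto
  then show ?thesis by simp
qed

text \<open>Positive indices are enough: |v|^2 is real, so its coefficients at n and -n are
  conjugate.\<close>

lemma constant_modulus_if_orthogonal:
  assumes v: "square_integrable circle v"
    and orth: "\<And>n. n > 0 \<Longrightarrow> (LINT z|circle. v z * cnj (z powi n * v z)) = 0"
  shows "AE z in circle. (cmod (v z))\<^sup>2 = (LINT z|circle. (cmod (v z))\<^sup>2)"
proof -
  define F where "F z = complex_of_real ((cmod (v z))\<^sup>2)" for z
  have F: "integrable circle F"
    using v unfolding F_def[abs_def] square_integrable_def by (intro integrable_of_real) auto
  have pos: "fourier_coeff F n = 0" if "n > 0" for n
  proof -
    have "fourier_coeff F n = (LINT z|circle. F z * z powi (- n))"
      using F by (simp add: fourier_coeff_eq)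
    also have "\<dots> = (LINT z|circle. v z * cnj (z powi n * v z))"
    proof (intro Bochner_Integration.integral_cong refl)
      fix z assume "z \<in> space circle"
      then have "cnj (z powi n) = z powi (- n)" by (intro cnj_powi_circle) simp
      then show "F z * z powi (- n) = v z * cnj (z powi n * v z)"
        unfolding F_def complex_norm_square complex_cnj_mult by (simp only: mult_ac)
    qed
    finally show ?thesis using orth[OF that] by simp
  qed
  have "fourier_coeff F n = 0" if "n \<noteq> 0" for n
  proof (cases "n > 0")
    case False
    have "fourier_coeff F n = (LINT z|circle. F z * z powi (- n))"
      by (rule fourier_coeff_eq[OF borel_measurable_integrable[OF F]])
    also have "\<dots> = (LINT z|circle. cnj (F z * z powi (- (- n))))"
    proof (intro Bochner_Integration.integral_cong refl)
      fix z assume "z \<in> space circle"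
      then have "cnj (z powi n) = z powi (- n)" by (intro cnj_powi_circle) simp
      then show "F z * z powi (- n) = cnj (F z * z powi (- (- n)))"
        unfolding complex_cnj_mult F_def complex_cnj_complex_of_real minus_minus by simp
    qed
    also have "\<dots> = cnj (fourier_coeff F (- n))"
      by (simp only: Bochner_Integration.integral_cnj fourier_coeff_eq[OF borel_measurable_integrable[OF F]])
    finally show ?thesis using pos[of "- n"] False that by simp
  qed (use pos in auto)
  from const_if_fourier_coeff_zero[OF F this]
  have "AE z in circle. F z = fourier_coeff F 0" .
  moreover have "fourier_coeff F 0 = complex_of_real (LINT z|circle. (cmod (v z))\<^sup>2)"
    using F unfolding fourier_coeff_eq[OF borel_measurable_integrable[OF F]] by (simp add: F_def del: of_real_power)
  ultimately show ?thesis
    by (simp add: F_def del: of_real_power)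
qed

text \<open>Continuity of the inner product in its first argument, arranged so that an exact value
  on approximants is inherited by the limit.\<close>

lemma integral_inner_limit:
  fixes v g :: "'a \<Rightarrow> 'b::{real_inner, second_countable_topology}"
  assumes v: "square_integrable M v" and g: "square_integrable M g"
    and approx: "\<And>e. e > 0 \<Longrightarrow> \<exists>u. square_integrable M u \<and> (LINT x|M. (norm (v x - u x))\<^sup>2) < e
      \<and> (LINT x|M. inner (u x) (g x)) = c"
  shows "(LINT x|M. inner (v x) (g x)) = c"
proof (rule ccontr)
  define G where "G = (LINT x|M. (norm (g x))\<^sup>2)"
  define a where "a = (LINT x|M. inner (v x) (g x)) - c"
  have G: "G \<ge> 0" by (simp add: G_def)
  assume "(LINT x|M. inner (v x) (g x)) \<noteq> c"
  \<comment> \<open>With this accuracy Cauchy-Schwarz gives a^2 \<le> a^2 G / (G + 1), impossible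
    for nonzero a.\<close>
  then have "a\<^sup>2 / (G + 1) > 0" using G by (simp add: a_def)
  then obtain u where u: "square_integrable M u" "(LINT x|M. (norm (v x - u x))\<^sup>2) < a\<^sup>2 / (G + 1)"
    "(LINT x|M. inner (u x) (g x)) = c"
    using approx by blast
  have "a = (LINT x|M. inner (v x - u x) (g x))"
    using u square_integrable_inner[OF v g] square_integrable_inner[OF u(1) g]
    by (simp add: a_def inner_diff_left)
  then have "a\<^sup>2 \<le> (LINT x|M. (norm (v x - u x))\<^sup>2) * G"
    unfolding G_def using integral_inner_le[OF square_integrable_diff[OF v u(1)] g] by simp
  also have "\<dots> \<le> a\<^sup>2 / (G + 1) * G"
    using u(2) G by (intro mult_right_mono) auto
  finally have "a\<^sup>2 * (G + 1) \<le> a\<^sup>2 * G" using G by (simp add: field_simps)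
  then have "a\<^sup>2 \<le> 0" by (simp add: algebra_simps)
  then show False using \<open>a\<^sup>2 / (G + 1) > 0\<close> by simp
qed

text \<open>Here \<open>N\<close> is already the shifted space: \<open>g\<close> may lie outside it,
  but \<open>z * g z\<close> lies inside. The result v is \<open>g\<close> minus its projection to
  \<open>N\<close>. It may vanish, and each application has to exclude this by an argument of its
  own. The last conclusion is Pythagoras: the projected part of \<open>g\<close> is orthogonal to
  v.\<close>

lemma wandering_projection:
  assumes N: "\<And>u. u \<in> N \<Longrightarrow> square_integrable circle u" "\<And>u. u \<in> N \<Longrightarrow> real_symmetric u"
    and zero: "(\<lambda>_. 0) \<in> N"
    and add: "\<And>u v. u \<in> N \<Longrightarrow> v \<in> N \<Longrightarrow> (\<lambda>z. u z + v z) \<in> N"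
    and scale: "\<And>c u. u \<in> N \<Longrightarrow> (\<lambda>z. c *\<^sub>R u z) \<in> N"
    and shift: "\<And>u. u \<in> N \<Longrightarrow> (\<lambda>z. z * u z) \<in> N"
    and g: "square_integrable circle g" "real_symmetric g" "(\<lambda>z. z * g z) \<in> N"
  obtains v where "square_integrable circle v" "real_symmetric v"
    and "\<And>u. u \<in> N \<Longrightarrow> (LINT z|circle. v z * cnj (u z)) = 0"
    and "\<And>e. e > 0 \<Longrightarrow> \<exists>u\<in>N. (LINT z|circle. (cmod (v z - (g z - u z)))\<^sup>2) < e"
    and "AE z in circle. (cmod (v z))\<^sup>2 = (LINT z|circle. (cmod (v z))\<^sup>2)"
    and "(LINT z|circle. g z * cnj (v z)) = complex_of_real (LINT z|circle. (cmod (v z))\<^sup>2)"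
proof -
  obtain h where h: "square_integrable circle h"
    and h_approx: "\<And>e. e > 0 \<Longrightarrow> \<exists>u\<in>N. (LINT z|circle. (cmod (h z - u z))\<^sup>2) < e"
    and h_orth: "\<And>u. u \<in> N \<Longrightarrow> (LINT z|circle. inner (g z - h z) (u z)) = 0"
    by (rule circle.square_integrable_projection[OF N(1) zero add scale g(1)]) (assumption | rule that)+
  define v where "v z = g z - h z" for z
  have v: "square_integrable circle v"
    unfolding v_def[abs_def] by (rule square_integrable_diff[OF g(1) h])
  have approx: "\<exists>u\<in>N. (LINT z|circle. (cmod (v z - (g z - u z)))\<^sup>2) < e" if "e > 0" for e
    using h_approx[OF that] by (simp add: v_def norm_minus_commute)
  \<comment> \<open>The projection is known only through approximation, so its symmetry is inherited
    from the approximants via closedness of \<open>RL1\<close>.\<close>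
  have "v \<in> RL1"
  proof (rule RL1_closed)
    show "integrable circle v" by (rule circle.integral_norm_le_square(1)[OF v])
    fix e :: real assume e: "e > 0"
    obtain u where u: "u \<in> N" "(LINT z|circle. (cmod (v z - (g z - u z)))\<^sup>2) < e\<^sup>2"
      using approx[of "e\<^sup>2"] e by auto
    have gu: "square_integrable circle (\<lambda>z. g z - u z)"
      by (intro square_integrable_diff g N u)
    have "(L1_norm (\<lambda>z. v z - (g z - u z)))\<^sup>2 < e\<^sup>2"
      using L1_norm_le_square[OF square_integrable_diff[OF v gu]] u(2) by (simp add: L1_norm_def)
    then have "L1_norm (\<lambda>z. v z - (g z - u z)) < e"
      using e by (intro power_less_imp_less_base[of _ 2 e]) auto
    moreover have "(\<lambda>z. g z - u z) \<in> RL1"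
      using circle.integral_norm_le_square(1)[OF gu] real_symmetric_diff[OF g(2) N(2)[OF u(1)]]
      by (simp add: RL1_iff)
    ultimately show "\<exists>g\<in>RL1. L1_norm (\<lambda>z. v z - g z) < e"
      by (intro bexI[of _ "\<lambda>z. g z - u z"])
  qed
  then have v_sym: "real_symmetric v" by (simp add: RL1_iff)
  have orth_inner: "(LINT z|circle. inner (u z) (v z)) = 0" if "u \<in> N" for u
    using h_orth[OF that] by (simp add: v_def inner_commute)
  have orth: "(LINT z|circle. v z * cnj (u z)) = 0" if "u \<in> N" for u
    using integral_mult_cnj[OF v N(1)[OF that] v_sym N(2)[OF that]] h_orth[OF that]
    by (simp add: v_def)
  have shift_n: "(\<lambda>z. z ^ n * u z) \<in> N" if "u \<in> N" for u n
  proof (induction n)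
    case (Suc n)
    from shift[OF this] show ?case by (simp add: mult.assoc)
  qed (use that in simp)
  have powi_v: "square_integrable circle (\<lambda>z. z powi n * v z)" for n
    by (rule square_integrable_circle_mult[OF v, of _ 1]) (auto simp: norm_powi_circle intro!: AE_I2)
  have v_powi: "(LINT z|circle. v z * cnj (z powi n * v z)) = 0" if "n > 0" for n
  proof -
    define m where "m = nat n - 1"
    have m: "n = int (Suc m)" using that by (simp add: m_def)
    have "(LINT z|circle. inner (z powi n * v z) (v z)) = 0"
    proof (rule integral_inner_limit[OF powi_v v])
      fix e :: real assume "e > 0"
      then obtain u where u: "u \<in> N" "(LINT z|circle. (cmod (v z - (g z - u z)))\<^sup>2) < e"
        using approx by blast
      \<comment> \<open>This is z^n (g - u), where n = m + 1. One factor z goes to \<open>g\<close>,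
        which puts \<open>z * g z\<close> and hence all of w into \<open>N\<close>; multiplication
        by z^n is isometric, so w is as close to z^n v as g - u is to v.\<close>
      define w where "w z = z ^ m * (z * g z) + (- 1) *\<^sub>R (z ^ Suc m * u z)" for z
      have w: "w \<in> N"
        unfolding w_def[abs_def] by (intro add scale shift_n g u)
      have "(LINT z|circle. (cmod (z powi n * v z - w z))\<^sup>2) = (LINT z|circle. (cmod (v z - (g z - u z)))\<^sup>2)"
      proof (intro Bochner_Integration.integral_cong refl)
        fix z assume "z \<in> space circle"
        then have z: "cmod z = 1" by simp
        have zn: "z powi n = z * z ^ m"
          unfolding m by (simp only: power_int_of_nat power_Suc)
        have "z powi n * v z - w z = z powi n * (v z - (g z - u z))"
          unfolding zn by (simp add: w_def algebra_simps)
        then show "(cmod (z powi n * v z - w z))\<^sup>2 = (cmod (v z - (g z - u z)))\<^sup>2"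
          using z by (simp add: norm_mult norm_powi_circle)
      qed
      moreover have "(LINT z|circle. inner (w z) (v z)) = 0"
        by (rule orth_inner[OF w])
      ultimately show "\<exists>w. square_integrable circle w \<and> (LINT z|circle. (norm (z powi n * v z - w z))\<^sup>2) < e
          \<and> (LINT z|circle. inner (w z) (v z)) = 0"
        using N(1)[OF w] u(2) by (intro exI[of _ w]) simp
    qed
    then show ?thesis
      using integral_mult_cnj[OF v powi_v v_sym real_symmetric_mult[OF real_symmetric_powi v_sym], of n]
      by (simp add: inner_commute)
  qed
  have gv: "(LINT z|circle. inner (g z) (v z)) = (LINT z|circle. (cmod (v z))\<^sup>2)"
  proof -
    have "(LINT z|circle. inner (h z) (v z)) = 0"
    proof (rule integral_inner_limit[OF h v])
      fix e :: real assume "e > 0"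
      then obtain u where "u \<in> N" "(LINT z|circle. (cmod (h z - u z))\<^sup>2) < e"
        using h_approx by blast
      then show "\<exists>u. square_integrable circle u \<and> (LINT z|circle. (norm (h z - u z))\<^sup>2) < e
          \<and> (LINT z|circle. inner (u z) (v z)) = 0"
        using N(1) orth_inner by (intro exI[of _ u]) simp
    qed
    moreover have "(LINT z|circle. inner (v z) (v z) + inner (h z) (v z))
        = (LINT z|circle. inner (v z) (v z)) + (LINT z|circle. inner (h z) (v z))"
      by (intro Bochner_Integration.integral_add square_integrable_inner h v)
    ultimately show ?thesis
      by (simp add: power2_norm_eq_inner v_def flip: inner_add_left)
  qed
  show ?thesis
    using that[OF v v_sym orth approx constant_modulus_if_orthogonal[OF v v_powi]]
      integral_mult_cnj[OF g(1) v g(2) v_sym] gv by simp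
qed

section \<open>Analytic multipliers\<close>

lemma integrable_poly_circle: "integrable circle (\<lambda>z. poly p z)" for p :: "complex poly"
proof -
  have "integrable circle (\<lambda>z. \<Sum>i\<le>degree p. coeff p i * z powi int i)"
    by (intro Bochner_Integration.integrable_sum integrable_mult_right integrable_powi)
  then show ?thesis by (simp add: poly_altdef)
qed

lemma integral_z_mult_poly: "(LINT z|circle. z * poly p z) = 0" for p :: "complex poly"
proof -
  have "z * poly p z = (\<Sum>i\<le>degree p. coeff p i * z powi int (Suc i))" for z
    unfolding poly_altdef power_int_of_nat by (simp add: sum_distrib_left mult_ac)
  then have "(LINT z|circle. z * poly p z)
      = (\<Sum>i\<le>degree p. LINT z|circle. coeff p i * z powi int (Suc i))"
    by (simp only:) (intro Bochner_Integration.integral_sum integrable_mult_right integrable_powi)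
  also have "\<dots> = 0" by (simp only: integral_mult_right_zero integral_powi) simp
  finally show ?thesis .
qed

lemma measurable_poly [measurable]: "(\<lambda>z. poly p z) \<in> borel_measurable circle" for p :: "complex poly"
  by (rule borel_measurable_integrable[OF integrable_poly_circle])

lemma poly_bounded_circle: "\<exists>B. \<forall>z. cmod z = 1 \<longrightarrow> cmod (poly p z) \<le> B" for p :: "complex poly"
proof -
  have "compact ((\<lambda>z. poly p z) ` sphere 0 1)"
    by (intro compact_continuous_image continuous_intros) auto
  then obtain B where "\<forall>x\<in>(\<lambda>z. poly p z) ` sphere 0 1. norm x \<le> B"
    using compact_imp_bounded bounded_iff by metis
  then show ?thesis by (intro exI[of _ B]) auto
qed

text \<open>A replacement for the outer function of modulus 1 / sqrt w. With \<open>\<phi>\<close> =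
  1 / sqrt w, the function v is the limit of \<open>\<phi>\<close> (1 - z p) along minimising p and
  has constant modulus d. Its orthogonality to \<open>z * z ^ m * \<phi> z\<close> says, after
  conjugation, that \<open>\<phi> * cnj v\<close> has no negative coefficients. The mean of
  \<open>k\<close> is d, because the inner product of \<open>\<phi>\<close> and v is d^2. The last
  inequality shows that the mean of \<open>k\<close> is not small when the mean of \<open>w\<close>
  is close to 1.\<close>

lemma exists_RH1_with_modulus:
  assumes w: "integrable circle w" and w1: "\<And>z. w z \<ge> (1::real)" and sym: "AE z in circle. w (cnj z) = w z"
  obtains k d where "k \<in> RH1" "AE z in circle. (cmod (k z))\<^sup>2 * w z = 1"
    "d > 0" "fourier_coeff k 0 = complex_of_real d" "1 \<le> d\<^sup>2 * (LINT z|circle. w z)"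
proof -
  define \<psi> where "\<psi> z = complex_of_real (sqrt (w z))" for z
  define \<phi> where "\<phi> z = complex_of_real (1 / sqrt (w z))" for z
  have [measurable]: "w \<in> borel_measurable circle" using w by auto
  have \<psi>\<phi>: "\<phi> z * \<psi> z = 1" for z
    using w1[of z] by (simp add: \<phi>_def \<psi>_def flip: of_real_mult)
  have \<phi>_le: "cmod (\<phi> z) \<le> 1" for z
    using w1[of z] by (simp add: \<phi>_def norm_divide del: of_real_divide)
  have [measurable]: "\<phi> \<in> borel_measurable circle" "\<psi> \<in> borel_measurable circle"
    unfolding \<phi>_def[abs_def] \<psi>_def[abs_def] by measurable
  have \<psi>_norm: "(cmod (\<psi> z))\<^sup>2 = w z" for z
    using w1[of z] by (simp add: \<psi>_def)
  have \<phi>_norm: "(cmod (\<phi> z))\<^sup>2 * w z = 1" for z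
    using w1[of z] by (simp add: \<phi>_def norm_divide power_divide)
  have \<psi>: "square_integrable circle \<psi>"
    using w by (simp add: square_integrable_def \<psi>_norm)
  have \<phi>: "square_integrable circle \<phi>"
    using square_integrable_circle_mult[OF circle.square_integrable_const[of 1], of \<phi> 1] \<phi>_le by simp
  have \<phi>_sym: "real_symmetric \<phi>"
    using sym unfolding real_symmetric_def by eventually_elim (simp add: \<phi>_def)
  \<comment> \<open>Real coefficients keep \<open>N\<close> within the symmetric functions. The
    factor z makes \<open>N\<close> the shift of the polynomial multiples of
    \<open>\<phi>\<close>.\<close>
  define N where "N = {u. \<exists>p. (\<forall>i. coeff p i \<in> \<real>) \<and> u = (\<lambda>z. z * poly p z * \<phi> z)}"
  have N_I: "(\<lambda>z. z * poly p z * \<phi> z) \<in> N" if "\<And>i. coeff p i \<in> \<real>" for p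
    using that unfolding N_def by blast
  have N_E: "\<exists>p. (\<forall>i. coeff p i \<in> \<real>) \<and> u = (\<lambda>z. z * poly p z * \<phi> z)" if "u \<in> N" for u
    using that unfolding N_def by blast
  have N_sq: "square_integrable circle u" if "u \<in> N" for u
  proof -
    from N_E[OF that] obtain p where p: "u = (\<lambda>z. z * poly p z * \<phi> z)" by blast
    obtain B where B: "\<And>z. cmod z = 1 \<Longrightarrow> cmod (poly p z) \<le> B" using poly_bounded_circle by blast
    show ?thesis
      unfolding p
    proof (rule square_integrable_circle_mult[OF \<phi>, of _ B])
      show "AE z in circle. cmod (z * poly p z) \<le> B"
        using B by (intro AE_I2) (simp add: norm_mult)
      have "(\<lambda>z. z powi 1 * poly p z) \<in> borel_measurable circle" by measurable
      then show "(\<lambda>z. z * poly p z) \<in> borel_measurable circle" by simp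
    qed
  qed
  obtain v where v: "square_integrable circle v" "real_symmetric v"
    and orth: "\<And>u. u \<in> N \<Longrightarrow> (LINT z|circle. v z * cnj (u z)) = 0"
    and approx: "\<And>e. e > 0 \<Longrightarrow> \<exists>u\<in>N. (LINT z|circle. (cmod (v z - (\<phi> z - u z)))\<^sup>2) < e"
    and const: "AE z in circle. (cmod (v z))\<^sup>2 = (LINT z|circle. (cmod (v z))\<^sup>2)"
    and \<phi>v: "(LINT z|circle. \<phi> z * cnj (v z)) = complex_of_real (LINT z|circle. (cmod (v z))\<^sup>2)"
  proof (rule wandering_projection[of N \<phi>])
    show "real_symmetric u" if u: "u \<in> N" for u
    proof -
      from N_E[OF u] obtain p where p: "\<forall>i. coeff p i \<in> \<real>" "u = (\<lambda>z. z * poly p z * \<phi> z)" by blast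
      have "real_symmetric (\<lambda>z. z * poly p z)"
        using poly_cnj_real[of p] p(1) by (simp add: real_symmetric_def)
      then show ?thesis unfolding p(2) by (rule real_symmetric_mult[OF _ \<phi>_sym])
    qed
    show "(\<lambda>_. 0) \<in> N" using N_I[of 0] by simp
    show "(\<lambda>z. u z + v z) \<in> N" if uv: "u \<in> N" "v \<in> N" for u v
    proof -
      from N_E[OF uv(1)] obtain p where p: "\<forall>i. coeff p i \<in> \<real>" "u = (\<lambda>z. z * poly p z * \<phi> z)" by blast
      from N_E[OF uv(2)] obtain q where q: "\<forall>i. coeff q i \<in> \<real>" "v = (\<lambda>z. z * poly q z * \<phi> z)" by blast
      have "(\<lambda>z. z * poly (p + q) z * \<phi> z) \<in> N"
        using p(1) q(1) by (intro N_I) simp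
      then show ?thesis unfolding p(2) q(2) poly_add distrib_left distrib_right .
    qed
    show "(\<lambda>z. c *\<^sub>R u z) \<in> N" if u: "u \<in> N" for c u
    proof -
      from N_E[OF u] obtain p where p: "\<forall>i. coeff p i \<in> \<real>" "u = (\<lambda>z. z * poly p z * \<phi> z)" by blast
      have "(\<lambda>z. z * poly (smult (complex_of_real c) p) z * \<phi> z) \<in> N"
        using p(1) by (intro N_I) simp
      then show ?thesis unfolding p(2) scaleR_conv_of_real poly_smult by (simp only: mult_ac)
    qed
    show "(\<lambda>z. z * u z) \<in> N" if u: "u \<in> N" for u
    proof -
      from N_E[OF u] obtain p where p: "\<forall>i. coeff p i \<in> \<real>" "u = (\<lambda>z. z * poly p z * \<phi> z)" by blast
      have "(\<lambda>z. z * poly (pCons 0 p) z * \<phi> z) \<in> N"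
        using p(1) by (intro N_I) (simp add: coeff_pCons split: nat.split)
      then show ?thesis unfolding p(2) by (simp add: mult.assoc)
    qed
    show "(\<lambda>z. z * \<phi> z) \<in> N"
      using N_I[of "[:1:]"] by (simp add: coeff_pCons split: nat.split)
  qed (assumption | rule N_sq \<phi> \<phi>_sym that)+
  define D where "D = (LINT z|circle. (cmod (v z))\<^sup>2)"
  \<comment> \<open>\<open>v\<close> is a limit of \<open>\<phi> (1 - z p)\<close>, and \<open>1 - z p\<close> has mean 1.\<close>
  have "(LINT z|circle. inner (v z) (\<psi> z)) = 1"
  proof (rule integral_inner_limit[OF v(1) \<psi>])
    fix e :: real assume "e > 0"
    then obtain u where u: "u \<in> N" "(LINT z|circle. (cmod (v z - (\<phi> z - u z)))\<^sup>2) < e"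
      using approx by blast
    from N_E[OF u(1)] obtain p where p: "u = (\<lambda>z. z * poly p z * \<phi> z)" by blast
    have "inner (\<phi> z - u z) (\<psi> z) = 1 - Re (z * poly p z)" for z
    proof -
      have "inner (\<phi> z - u z) (\<psi> z) = Re ((\<phi> z - u z) * \<psi> z)"
        unfolding inner_complex_Re by (simp add: \<psi>_def)
      also have "(\<phi> z - u z) * \<psi> z = (1 - z * poly p z) * (\<phi> z * \<psi> z)"
        unfolding p by (simp add: algebra_simps)
      finally show ?thesis by (simp add: \<psi>\<phi> del: times_complex.sel)
    qed
    moreover have "(LINT z|circle. 1 - Re (z * poly p z)) = 1"
    proof -
      have "integrable circle (\<lambda>z. poly (pCons 0 p) z)" by (rule integrable_poly_circle)
      then have i: "integrable circle (\<lambda>z. z * poly p z)" by simp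
      have "(LINT z|circle. Re (z * poly p z)) = 0"
        using integral_Re[OF i] integral_z_mult_poly[of p] by simp
      moreover have "(LINT z|circle. 1 - Re (z * poly p z)) = (LINT z|circle. 1) - (LINT z|circle. Re (z * poly p z))"
        by (intro Bochner_Integration.integral_diff integrable_Re i) simp
      ultimately show ?thesis by simp
    qed
    ultimately have "(LINT z|circle. inner (\<phi> z - u z) (\<psi> z)) = 1" by (simp only:)
    then show "\<exists>u. square_integrable circle u \<and> (LINT z|circle. (norm (v z - u z))\<^sup>2) < e
        \<and> (LINT z|circle. inner (u z) (\<psi> z)) = 1"
      using u(2) square_integrable_diff[OF \<phi> N_sq[OF u(1)]] by (intro exI[of _ "\<lambda>z. \<phi> z - u z"] conjI)
  qed
  \<comment> \<open>Cauchy-Schwarz for v and \<open>\<psi>\<close> = 1 / \<open>\<phi>\<close>. This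
    is where v is seen to be nonzero, so that the division by d is legitimate.\<close>
  then have DW: "1 \<le> D * (LINT z|circle. w z)"
    using integral_inner_le[OF v(1) \<psi>] by (simp add: D_def \<psi>_norm)
  moreover have "D \<ge> 0" by (simp add: D_def)
  ultimately have D: "D > 0" by (cases "D = 0") auto
  define d where "d = sqrt D"
  have d: "d > 0" "d\<^sup>2 = D" using D by (auto simp: d_def)
  \<comment> \<open>The conjugate of v is what makes \<open>k\<close> analytic: v was made
    orthogonal to shifts by positive powers. Since |v| = d almost everywhere, |k| equals
    \<open>\<phi>\<close>.\<close>
  define k where "k z = \<phi> z * cnj (v z) / complex_of_real d" for z
  have k_int: "integrable circle k"
    unfolding k_def[abs_def] by (intro integrable_divide_zero integrable_mult_cnj \<phi> v)
  have k_coeff: "fourier_coeff k n = (LINT z|circle. \<phi> z * cnj (v z) * z powi (- n)) / complex_of_real d" for n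
    using fourier_coeff_eq[OF borel_measurable_integrable[OF k_int], of n] by (simp add: k_def)
  have "real_symmetric k"
    using real_symmetric_mult[OF \<phi>_sym real_symmetric_cnj[OF v(2)]]
    unfolding real_symmetric_def by eventually_elim (simp add: k_def)
  moreover have "fourier_coeff k n = 0" if "n < 0" for n
  proof -
    define m where "m = nat (- n) - 1"
    have m: "- n = int (Suc m)" using that by (simp add: m_def)
    have zm: "z powi (- n) = z * z ^ m" for z :: complex
      unfolding m by (simp only: power_int_of_nat power_Suc)
    have "(\<lambda>z. z * z ^ m * \<phi> z) \<in> N"
      using N_I[of "monom 1 m"] by (simp add: poly_monom)
    from orth[OF this] have "cnj (LINT z|circle. v z * cnj (z * z ^ m * \<phi> z)) = 0" by (simp only: complex_cnj_zero)
    then have "(LINT z|circle. cnj (v z * cnj (z * z ^ m * \<phi> z))) = 0"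
      by (simp only: Bochner_Integration.integral_cnj)
    then have "(LINT z|circle. \<phi> z * cnj (v z) * z powi (- n)) = 0"
      unfolding zm by (simp add: mult_ac)
    then show ?thesis by (simp add: k_coeff)
  qed
  ultimately have "k \<in> RH1"
    using k_int RL1_iff[of k] by (auto simp: RH1_def H1_def RL1_def L1_def)
  moreover have "AE z in circle. (cmod (k z))\<^sup>2 * w z = 1"
    using const
  proof eventually_elim
    case (elim z)
    then have "(cmod (v z))\<^sup>2 = D" by (simp add: D_def)
    then have "(cmod (k z))\<^sup>2 = (cmod (\<phi> z))\<^sup>2"
      using d D by (simp add: k_def norm_mult norm_divide power_mult_distrib power_divide)
    then show ?case by (simp add: \<phi>_norm)
  qed
  moreover have "fourier_coeff k 0 = complex_of_real d"
    using \<phi>v d unfolding D_def[symmetric] by (simp add: k_coeff power2_eq_square flip: d(2))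
  ultimately show ?thesis
    using that[of k d] d DW by simp
qed

text \<open>Every element of \<open>RL1\<close> is an L1 limit of square integrable multiples of
  itself by bounded analytic functions. Once such multiples are known to stay in \<open>M\<close>,
  the square integrable part of \<open>M\<close> is dense in \<open>M\<close>.\<close>

lemma RH1_multiplier_approx:
  assumes f: "f \<in> RL1" and e: "e > 0"
  obtains k where "k \<in> RH1" "AE z in circle. cmod (k z) \<le> 1"
    "square_integrable circle (\<lambda>z. k z * f z)" "(LINT z|circle. cmod (f z - k z * f z)) < e"
proof -
  have fi: "integrable circle f" and f_sym: "real_symmetric f" using f by (auto simp: RL1_iff)
  have [measurable]: "f \<in> borel_measurable circle" using fi by auto
  define F where "F = (LINT z|circle. cmod (f z))"
  have F: "F \<ge> 0" by (simp add: F_def)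
  define \<epsilon> where "\<epsilon> n = 1 / real (Suc n)" for n
  have \<epsilon>: "\<epsilon> n > 0" for n by (simp add: \<epsilon>_def)
  define w where "w n z = 1 + \<epsilon> n * cmod (f z)" for n z
  have w_int: "integrable circle (w n)" for n
    unfolding w_def[abs_def] using fi by auto
  have w1: "w n z \<ge> 1" for n z using \<epsilon>[of n] by (simp add: w_def)
  have w_sym: "AE z in circle. w n (cnj z) = w n z" for n
    using f_sym unfolding real_symmetric_def by eventually_elim (simp add: w_def)
  have W: "(LINT z|circle. w n z) = 1 + \<epsilon> n * F" for n
    using fi by (simp add: w_def F_def)
  have "\<forall>n. \<exists>k d. k \<in> RH1 \<and> (AE z in circle. (cmod (k z))\<^sup>2 * w n z = 1) \<and> d > 0
      \<and> fourier_coeff k 0 = complex_of_real d \<and> 1 \<le> d\<^sup>2 * (1 + \<epsilon> n * F)"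
    unfolding W[symmetric] by (intro allI, rule exists_RH1_with_modulus[OF w_int w1 w_sym]) blast
  from choice[OF this] obtain k where "\<forall>n. \<exists>d. k n \<in> RH1 \<and> (AE z in circle. (cmod (k n z))\<^sup>2 * w n z = 1) \<and> d > 0
      \<and> fourier_coeff (k n) 0 = complex_of_real d \<and> 1 \<le> d\<^sup>2 * (1 + \<epsilon> n * F)" ..
  from choice[OF this] obtain d where kd_all: "\<forall>n. k n \<in> RH1 \<and> (AE z in circle. (cmod (k n z))\<^sup>2 * w n z = 1)
      \<and> d n > 0 \<and> fourier_coeff (k n) 0 = complex_of_real (d n) \<and> 1 \<le> (d n)\<^sup>2 * (1 + \<epsilon> n * F)" ..
  have k: "\<And>n. k n \<in> RH1" and kw: "\<And>n. AE z in circle. (cmod (k n z))\<^sup>2 * w n z = 1"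
    and d: "\<And>n. d n > 0" and kd: "\<And>n. fourier_coeff (k n) 0 = complex_of_real (d n)"
    and dW: "\<And>n. 1 \<le> (d n)\<^sup>2 * (1 + \<epsilon> n * F)"
    using kd_all by blast+
  have k_int: "integrable circle (k n)" for n using k[of n] by (simp add: RH1_def H1_def L1_def)
  have [measurable]: "k n \<in> borel_measurable circle" for n using k_int by auto
  have k1: "AE z in circle. cmod (k n z) \<le> 1" for n
    using kw[of n]
  proof eventually_elim
    case (elim z)
    then have "(cmod (k n z))\<^sup>2 \<le> 1"
      using mult_left_mono[OF w1[of n z], of "(cmod (k n z))\<^sup>2"] by simp
    then show ?case by (simp add: power_le_one_iff abs_square_le_1)
  qed
  have k_sq: "square_integrable circle (k n)" for n
    using square_integrable_circle_mult[OF circle.square_integrable_const[of 1], of "k n" 1] k1 by simp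
  have kf_sq: "square_integrable circle (\<lambda>z. k n z * f z)" for n
    unfolding square_integrable_def
  proof
    \<comment> \<open>From |k|^2 \<epsilon> |f| \<le> |k|^2 w = 1 it follows that |k f|^2 \<le> |f|
      / \<epsilon>.\<close>
    have "integrable circle (\<lambda>z. cmod (f z) / \<epsilon> n)" using fi by auto
    then show "integrable circle (\<lambda>z. (cmod (k n z * f z))\<^sup>2)"
    proof (rule Bochner_Integration.integrable_bound)
      show "AE z in circle. norm ((cmod (k n z * f z))\<^sup>2) \<le> norm (cmod (f z) / \<epsilon> n)"
        using kw[of n]
      proof eventually_elim
        case (elim z)
        have "(cmod (k n z))\<^sup>2 * (\<epsilon> n * cmod (f z)) \<le> (cmod (k n z))\<^sup>2 * w n z"
          by (intro mult_left_mono) (auto simp: w_def)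
        then have "(cmod (k n z))\<^sup>2 * (\<epsilon> n * cmod (f z)) \<le> 1" using elim by simp
        then have "(cmod (k n z))\<^sup>2 * (\<epsilon> n * cmod (f z)) * cmod (f z) \<le> 1 * cmod (f z)"
          by (intro mult_right_mono) auto
        then show ?case
          using \<epsilon>[of n] by (simp add: norm_mult power_mult_distrib field_simps power2_eq_square)
      qed
    qed measurable
  qed measurable
  \<comment> \<open>As \<open>\<bar>k\<bar> \<le> 1\<close>, the left side is at most \<open>2 - 2 d\<close>, where the mean \<open>d\<close> of \<open>k\<close> tends to 1.\<close>
  have k_close: "(LINT z|circle. (cmod (k n z - 1))\<^sup>2) \<le> 2 * \<epsilon> n * F" for n
  proof -
    have one: "square_integrable circle (\<lambda>_. 1 :: complex)" by (rule circle.square_integrable_const)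
    have "(LINT z|circle. inner (k n z) 1) = d n"
    proof -
      have "(LINT z|circle. inner (k n z) 1) = Re (LINT z|circle. k n z)"
        using k_int[of n] by (simp add: inner_complex_def)
      then show ?thesis
        using kd[of n] k_int[of n] by (simp add: fourier_coeff_eq)
    qed
    then have "(LINT z|circle. (cmod (k n z - 1))\<^sup>2) = (LINT z|circle. (cmod (k n z))\<^sup>2) - 2 * d n + 1"
      using integral_norm_diff_scaleR[OF k_sq one, of n 1] by simp
    also have "(LINT z|circle. (cmod (k n z))\<^sup>2) \<le> (LINT z|circle. 1)"
    proof (rule integral_mono_AE)
      show "AE z in circle. (cmod (k n z))\<^sup>2 \<le> 1"
        using k1[of n] by eventually_elim (simp add: power_le_one)
    qed (use k_sq in \<open>auto simp: square_integrable_def\<close>)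
    finally have *: "(LINT z|circle. (cmod (k n z - 1))\<^sup>2) \<le> 2 - 2 * d n" by simp
    moreover have "0 \<le> (LINT z|circle. (cmod (k n z - 1))\<^sup>2)" by simp
    ultimately have d1: "d n \<le> 1" by linarith
    \<comment> \<open>Replaces the quadratic inequality 1 \<le> d^2 (1 + \<epsilon> F) by the linear
      one 1 - d \<le> \<epsilon> F.\<close>
    have "(d n)\<^sup>2 \<le> d n"
      using d1 d[of n] by (simp add: power2_eq_square mult_left_le)
    then have "(d n)\<^sup>2 * (1 + \<epsilon> n * F) \<le> d n * (1 + \<epsilon> n * F)"
      using F \<epsilon>[of n] by (intro mult_right_mono) auto
    then have "1 \<le> d n + d n * (\<epsilon> n * F)"
      using dW[of n] by (simp add: distrib_left)
    also have "d n * (\<epsilon> n * F) \<le> \<epsilon> n * F"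
      using d1 d[of n] F \<epsilon>[of n] by (intro mult_left_le_one_le) auto
    finally have "2 - 2 * d n \<le> 2 * \<epsilon> n * F" by simp
    with * show ?thesis by linarith
  qed
  have "(\<lambda>n. LINT z|circle. cmod (k n z - 1)) \<longlonglongrightarrow> 0"
  proof -
    have "(LINT z|circle. cmod (k n z - 1))\<^sup>2 \<le> 2 * \<epsilon> n * F" for n
      using L1_norm_le_square[OF square_integrable_diff[OF k_sq circle.square_integrable_const[of 1]], of n] k_close[of n]
      by linarith
    moreover have "(\<lambda>n. 2 * \<epsilon> n * F) \<longlonglongrightarrow> 0"
      using tendsto_mult[OF tendsto_mult[OF tendsto_const[of "2::real"] LIMSEQ_Suc[OF lim_1_over_n]] tendsto_const[of F]]
      by (simp add: \<epsilon>_def)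
    ultimately have "(\<lambda>n. (LINT z|circle. cmod (k n z - 1))\<^sup>2) \<longlonglongrightarrow> 0"
      by (intro Lim_null_comparison[of "\<lambda>n. (LINT z|circle. cmod (k n z - 1))\<^sup>2" "\<lambda>n. 2 * \<epsilon> n * F"]) auto
    then show ?thesis by (rule power_tendsto_0_iff[THEN iffD1, rotated]) simp
  qed
  \<comment> \<open>Convergence of \<open>k\<close> in mean says nothing about its product with an
    unbounded \<open>f\<close>. Almost everywhere convergence along a subsequence does, since 2 |f|
    dominates.\<close>
  then obtain r where r: "strict_mono r" and lim: "AE z in circle. (\<lambda>n. k (r n) z - 1) \<longlonglongrightarrow> 0"
    using tendsto_L1_AE_subseq[of circle "\<lambda>n z. k n z - 1"] k_int by auto
  have "(\<lambda>n. LINT z|circle. cmod (f z - k (r n) z * f z)) \<longlonglongrightarrow> 0"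
  proof (rule tendsto_integral_norm_0)
    show "integrable circle (\<lambda>z. 2 * cmod (f z))" using fi by auto
    show "AE z in circle. (\<lambda>n. f z - k (r n) z * f z) \<longlonglongrightarrow> 0"
      using lim
    proof eventually_elim
      case (elim z)
      from tendsto_mult[OF elim tendsto_const[of "- f z"]] show ?case
        by (simp add: algebra_simps)
    qed
    show "AE z in circle. cmod (f z - k (r n) z * f z) \<le> 2 * cmod (f z)" for n
      using k1[of "r n"]
    proof eventually_elim
      case (elim z)
      have "cmod (f z - k (r n) z * f z) \<le> cmod (f z) + cmod (k (r n) z) * cmod (f z)"
        using norm_triangle_ineq4[of "f z" "k (r n) z * f z"] by (simp add: norm_mult)
      also have "\<dots> \<le> cmod (f z) + 1 * cmod (f z)"
        using elim by (intro add_left_mono mult_right_mono) auto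
      finally show ?case by simp
    qed
  qed measurable
  from order_tendstoD(2)[OF this e]
  have "\<forall>\<^sub>F n in sequentially. (LINT z|circle. cmod (f z - k (r n) z * f z)) < e" .
  from eventually_happens'[OF sequentially_bot this]
  obtain n where "(LINT z|circle. cmod (f z - k (r n) z * f z)) < e" ..
  with k k1 kf_sq show ?thesis by (intro that[of "k (r n)"])
qed

section \<open>Invariant subspaces\<close>

text \<open>The terms with i < j carry a negative index and vanish, so the mean is a genuine
  polynomial with real coefficients, and an invariant subspace is closed under multiplication by
  it.\<close>

lemma fejer_mean_RH1_poly:
  assumes h: "h \<in> RH1"
  obtains p where "\<And>i. coeff p i \<in> \<real>" "\<And>z. fejer_mean N h z = poly p z"
proof
  define q where "q i j = (if j \<le> i then monom (fourier_coeff h (int i - int j)) (i - j) else 0)" for i j :: nat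
  define p where "p = smult (1 / of_nat N) (\<Sum>i<N. \<Sum>j<N. q i j)"
  have real: "fourier_coeff h n \<in> \<real>" for n using h by (simp add: RH1_def)
  have neg: "fourier_coeff h n = 0" if "n < 0" for n using h that by (simp add: RH1_def H1_def)
  have "coeff (q i j) m \<in> \<real>" for i j m using real by (simp add: q_def)
  then have "(\<Sum>i<N. \<Sum>j<N. coeff (q i j) m) \<in> \<real>" for m by (intro sum_in_Reals)
  then show "coeff p m \<in> \<real>" for m
    by (simp add: p_def coeff_sum)
  fix z
  have "fourier_coeff h (int i - int j) * z powi (int i - int j) = poly (q i j) z" for i j
  proof (cases "j \<le> i")
    case True
    then have *: "int i - int j = int (i - j)" by simp
    show ?thesis using True unfolding q_def * power_int_of_nat by (simp add: poly_monom)
  qed (simp add: q_def neg)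
  then show "fejer_mean N h z = poly p z"
    by (simp add: fejer_mean_def p_def poly_sum)
qed

lemma fourier_coeff_const: "fourier_coeff (\<lambda>_. c) n = (if n = 0 then c else 0)"
proof -
  have "fourier_coeff (\<lambda>z. c * z powi 0) n = c * fourier_coeff (\<lambda>z. z powi 0) n"
    by (rule fourier_coeff_cmult) (rule integrable_powi)
  then show ?thesis by (simp add: fourier_coeff_powi[of 0, simplified])
qed

lemma RH1_iff: "h \<in> RH1 \<longleftrightarrow> h \<in> RL1 \<and> (\<forall>n<0. fourier_coeff h n = 0)"
  by (auto simp: RH1_def H1_def RL1_def)

lemma one_in_RH1: "(\<lambda>_. 1) \<in> RH1"
  unfolding RH1_iff by (auto simp: RL1_def L1_def fourier_coeff_const)

section \<open>Closure properties and the generator of an invariant subspace\<close>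

context
  fixes M :: "(complex \<Rightarrow> complex) set"
  assumes M: "invariant_subspace_RL1 M"
begin

lemma invariant_RL1: "f \<in> M \<Longrightarrow> f \<in> RL1"
  using M by (auto simp: invariant_subspace_RL1_def closed_subspace_RL1_def)

lemma invariant_integrable: "f \<in> M \<Longrightarrow> integrable circle f"
  using invariant_RL1 by (simp add: RL1_iff)

lemma invariant_zero: "(\<lambda>_. 0) \<in> M"
  using M by (auto simp: invariant_subspace_RL1_def closed_subspace_RL1_def)

lemma invariant_add: "f \<in> M \<Longrightarrow> g \<in> M \<Longrightarrow> (\<lambda>z. f z + g z) \<in> M"
  using M by (auto simp: invariant_subspace_RL1_def closed_subspace_RL1_def)

lemma invariant_scaleR: "f \<in> M \<Longrightarrow> (\<lambda>z. c *\<^sub>R f z) \<in> M"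
  using M by (auto simp: invariant_subspace_RL1_def closed_subspace_RL1_def)

lemma invariant_closed:
  assumes "f \<in> RL1" "\<And>e. e > 0 \<Longrightarrow> \<exists>g\<in>M. (LINT z|circle. cmod (f z - g z)) < e"
  shows "f \<in> M"
  using M assms by (auto simp: invariant_subspace_RL1_def closed_subspace_RL1_def L1_norm_def)

lemma invariant_closed_sequentially:
  assumes "f \<in> RL1" "\<And>n. g n \<in> M" "(\<lambda>n. LINT z|circle. cmod (f z - g n z)) \<longlonglongrightarrow> 0"
  shows "f \<in> M"
proof (rule invariant_closed[OF assms(1)])
  fix e :: real assume "e > 0"
  from eventually_happens'[OF sequentially_bot order_tendstoD(2)[OF assms(3) this]]
  obtain n where "(LINT z|circle. cmod (f z - g n z)) < e" ..
  with assms(2) show "\<exists>g\<in>M. (LINT z|circle. cmod (f z - g z)) < e" by (intro bexI[of _ "g n"])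
qed

text \<open>No symmetry of \<open>f\<close> has to be supplied: it is inherited from the
  approximants through \<open>RL1_closed\<close>.\<close>

lemma invariant_closed_L2:
  assumes f: "square_integrable circle f"
    and approx: "\<And>e. e > 0 \<Longrightarrow> \<exists>g\<in>M. square_integrable circle g \<and> (LINT z|circle. (cmod (f z - g z))\<^sup>2) < e"
  shows "f \<in> M"
proof -
  have *: "\<exists>g\<in>M. (LINT z|circle. cmod (f z - g z)) < e" if e: "e > 0" for e
  proof -
    obtain g where g: "g \<in> M" "square_integrable circle g" "(LINT z|circle. (cmod (f z - g z))\<^sup>2) < e\<^sup>2"
      using approx[of "e\<^sup>2"] e by auto
    have "(LINT z|circle. cmod (f z - g z))\<^sup>2 < e\<^sup>2"
      using L1_norm_le_square[OF square_integrable_diff[OF f g(2)]] g(3) by simp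
    then have "(LINT z|circle. cmod (f z - g z)) < e"
      using e by (intro power_less_imp_less_base[of _ 2 e]) auto
    with g(1) show ?thesis by (intro bexI[of _ g])
  qed
  have "f \<in> RL1"
  proof (rule RL1_closed)
    show "integrable circle f" by (rule circle.integral_norm_le_square(1)[OF f])
    show "\<exists>g\<in>RL1. L1_norm (\<lambda>z. f z - g z) < e" if "e > 0" for e
      using *[OF that] invariant_RL1 unfolding L1_norm_def by blast
  qed
  then show ?thesis using * by (rule invariant_closed)
qed

lemma invariant_cong_AE:
  assumes f: "f \<in> M" and g: "g \<in> borel_measurable circle" and eq: "AE z in circle. g z = f z"
  shows "g \<in> M"
proof (rule invariant_closed_sequentially[of g "\<lambda>_. f"])
  have gi: "integrable circle g"
    using integrable_cong_AE[OF g borel_measurable_integrable[OF invariant_integrable[OF f]] eq]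
      invariant_integrable[OF f] by simp
  have "AE z in circle. f z = g z" using eq by eventually_elim simp
  with gi show "g \<in> RL1"
    using invariant_RL1[OF f] real_symmetric_cong_AE[of f g] by (simp add: RL1_iff)
  have "AE z in circle. cmod (g z - f z) = 0" using eq by eventually_elim simp
  then have "(LINT z|circle. cmod (g z - f z)) = (LINT z|circle. 0)"
    by (intro integral_cong_AE) (use gi invariant_integrable[OF f] in auto)
  then show "(\<lambda>_. LINT z|circle. cmod (g z - f z)) \<longlonglongrightarrow> 0" by simp
qed (rule f)

lemma invariant_shift:
  assumes f: "f \<in> M"
  shows "(\<lambda>z. z * f z) \<in> M"
proof -
  have "(\<lambda>z. z powi 1 * f z) \<in> borel_measurable circle"
    using borel_measurable_integrable[OF invariant_integrable[OF f]] by measurable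
  then have "(\<lambda>z. z * f z) \<in> mult_set (\<lambda>z. z) M"
    using f by (auto simp: mult_set_def)
  then show ?thesis using M by (auto simp: invariant_subspace_RL1_def)
qed

lemma invariant_power: "f \<in> M \<Longrightarrow> (\<lambda>z. z ^ n * f z) \<in> M"
proof (induction n)
  case (Suc n)
  from invariant_shift[OF Suc.IH[OF Suc.prems]] show ?case by (simp add: mult.assoc)
qed simp

lemma invariant_poly:
  assumes f: "f \<in> M"
  shows "\<forall>i. coeff p i \<in> \<real> \<Longrightarrow> (\<lambda>z. poly p z * f z) \<in> M"
proof (induction p)
  case 0
  show ?case using invariant_zero by simp
next
  case (pCons a p)
  have "coeff p i \<in> \<real>" for i using pCons.prems[rule_format, of "Suc i"] by simp
  then have p: "(\<lambda>z. poly p z * f z) \<in> M" using pCons.IH by simp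
  have "a \<in> \<real>" using pCons.prems[rule_format, of 0] by simp
  then obtain r where r: "a = complex_of_real r" by (auto elim: Reals_cases)
  have "(\<lambda>z. r *\<^sub>R f z + z * (poly p z * f z)) \<in> M"
    by (intro invariant_add invariant_scaleR f invariant_shift p)
  then show ?case by (simp add: r scaleR_conv_of_real distrib_right mult.assoc)
qed

lemma invariant_fejer_mean:
  assumes "h \<in> RH1" "f \<in> M"
  shows "(\<lambda>z. fejer_mean N h z * f z) \<in> M"
proof -
  obtain p where "\<And>i. coeff p i \<in> \<real>" "\<And>z. fejer_mean N h z = poly p z"
    by (rule fejer_mean_RH1_poly[OF assms(1), of N]) (assumption | rule that)+
  then show ?thesis using invariant_poly[OF assms(2), of p] by simp
qed

text \<open>Convergence of the Fejer means of \<open>k\<close> in L1 would not survive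
  multiplication by an unbounded \<open>f\<close>. The bound by 1 does the work: it passes to the
  means, and with an a.e. convergent subsequence it permits dominated convergence.\<close>

lemma invariant_bounded_mult:
  assumes k: "k \<in> RH1" and k1: "AE z in circle. cmod (k z) \<le> 1" and f: "f \<in> M"
  shows "(\<lambda>z. k z * f z) \<in> M"
proof -
  have k_int: "integrable circle k" and k_sym: "real_symmetric k"
    using k by (auto simp: RH1_iff RL1_iff)
  have f_int: "integrable circle f" and f_sym: "real_symmetric f"
    using invariant_RL1[OF f] by (auto simp: RL1_iff)
  note [measurable] = borel_measurable_integrable[OF k_int] borel_measurable_integrable[OF f_int]
    borel_measurable_integrable[OF integrable_fejer_mean]
  \<comment> \<open>The shift of the index avoids N = 0, where the kernel does not have mass
    1.\<close>
  have "(\<lambda>N. LINT z|circle. cmod (fejer_mean (Suc N) k z - k z)) \<longlonglongrightarrow> 0"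
    by (rule LIMSEQ_Suc[OF fejer_mean_tendsto_L1[OF k_int]])
  then obtain r where lim: "AE z in circle. (\<lambda>n. fejer_mean (Suc (r n)) k z - k z) \<longlonglongrightarrow> 0"
    using tendsto_L1_AE_subseq[of circle "\<lambda>N z. fejer_mean (Suc N) k z - k z"] k_int integrable_fejer_mean
    by auto
  show ?thesis
  proof (rule invariant_closed_sequentially)
    have "integrable circle (\<lambda>z. k z * f z)"
      by (rule Bochner_Integration.integrable_bound[OF f_int])
        (use k1 in \<open>auto simp: norm_mult intro: mult_left_le_one_le elim!: eventually_mono\<close>)
    then show "(\<lambda>z. k z * f z) \<in> RL1"
      using real_symmetric_mult[OF k_sym f_sym] by (simp add: RL1_iff)
    show "(\<lambda>z. fejer_mean (Suc (r n)) k z * f z) \<in> M" for n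
      by (rule invariant_fejer_mean[OF k f])
    show "(\<lambda>n. LINT z|circle. cmod (k z * f z - fejer_mean (Suc (r n)) k z * f z)) \<longlonglongrightarrow> 0"
    proof (rule tendsto_integral_norm_0)
      show "integrable circle (\<lambda>z. 2 * cmod (f z))" using f_int by auto
      show "AE z in circle. (\<lambda>n. k z * f z - fejer_mean (Suc (r n)) k z * f z) \<longlonglongrightarrow> 0"
        using lim
      proof eventually_elim
        case (elim z)
        from tendsto_mult[OF elim tendsto_const[of "- f z"]] show ?case by (simp add: algebra_simps)
      qed
      show "AE z in circle. cmod (k z * f z - fejer_mean (Suc (r n)) k z * f z) \<le> 2 * cmod (f z)" for n
        using k1 AE_circle_norm
      proof eventually_elim
        case (elim z)
        have "cmod (fejer_mean (Suc (r n)) k z) \<le> 1"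
          by (rule norm_fejer_mean_le[OF k_int k1 elim(2)]) simp
        then have "cmod (k z - fejer_mean (Suc (r n)) k z) \<le> 2"
          using norm_triangle_ineq4[of "k z" "fejer_mean (Suc (r n)) k z"] elim(1) by linarith
        then have "cmod (k z - fejer_mean (Suc (r n)) k z) * cmod (f z) \<le> 2 * cmod (f z)"
          by (rule mult_right_mono) simp
        then show ?case by (simp add: norm_mult flip: left_diff_distrib)
      qed
    qed measurable
  qed
qed

text \<open>Here h may be unbounded: multiplication by a unimodular \<open>U\<close> is an L1
  isometry, so L1 convergence of the Fejer means of h is enough.\<close>

lemma invariant_contains_unimodular_mult_RH1:
  assumes U: "U \<in> M" "unimodular U"
  shows "mult_set U RH1 \<subseteq> M"
proof
  fix g assume "g \<in> mult_set U RH1"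
  then obtain h where g: "g \<in> borel_measurable circle" and h: "h \<in> RH1"
    and gU: "AE z in circle. g z = U z * h z" by (auto simp: mult_set_def)
  have h_int: "integrable circle h" and h_sym: "real_symmetric h"
    using h by (auto simp: RH1_iff RL1_iff)
  have U_int: "integrable circle U" and U_sym: "real_symmetric U"
    using invariant_RL1[OF U(1)] by (auto simp: RL1_iff)
  have U1: "AE z in circle. cmod (U z) = 1" using U(2) by (simp add: unimodular_def)
  note [measurable] = borel_measurable_integrable[OF h_int] borel_measurable_integrable[OF U_int]
    borel_measurable_integrable[OF integrable_fejer_mean]
  have "(\<lambda>z. U z * h z) \<in> M"
  proof (rule invariant_closed_sequentially)
    have "integrable circle (\<lambda>z. U z * h z)"
      by (rule Bochner_Integration.integrable_bound[OF h_int])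
        (use U1 in \<open>auto simp: norm_mult elim!: eventually_mono\<close>)
    then show "(\<lambda>z. U z * h z) \<in> RL1"
      using real_symmetric_mult[OF U_sym h_sym] by (simp add: RL1_iff)
    show "(\<lambda>z. fejer_mean n h z * U z) \<in> M" for n
      by (rule invariant_fejer_mean[OF h U(1)])
    have "(LINT z|circle. cmod (U z * h z - fejer_mean n h z * U z)) = (LINT z|circle. cmod (fejer_mean n h z - h z))" for n
    proof (rule integral_cong_AE)
      show "AE z in circle. cmod (U z * h z - fejer_mean n h z * U z) = cmod (fejer_mean n h z - h z)"
        using U1
      proof eventually_elim
        case (elim z)
        have "U z * h z - fejer_mean n h z * U z = U z * (h z - fejer_mean n h z)"
          by (simp add: algebra_simps)
        then show ?case using elim by (simp add: norm_mult norm_minus_commute)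
      qed
    qed measurable
    then show "(\<lambda>n. LINT z|circle. cmod (U z * h z - fejer_mean n h z * U z)) \<longlonglongrightarrow> 0"
      using fejer_mean_tendsto_L1[OF h_int] by simp
  qed
  then show "g \<in> M" using g gU by (rule invariant_cong_AE)
qed

text \<open>The generator is the normalised component of a square integrable \<open>g\<close> in
  \<open>M\<close> orthogonal to z times the square integrable part of \<open>M\<close>. The
  quotient of any element of \<open>M\<close> by it is then analytic, because v is orthogonal to all
  positive shifts of that part.\<close>

lemma simply_invariant_generator:
  assumes simple: "mult_set (\<lambda>z. z) M \<noteq> M"
  obtains U where "U \<in> M" "unimodular U" "M \<subseteq> mult_set U RH1"
proof -
  \<comment> \<open>Restates strictness without products: some \<open>f\<close> in \<open>M\<close>
    has \<open>cnj z * f z\<close> outside \<open>M\<close>.\<close>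
  have shift_mem: "f \<in> mult_set (\<lambda>z. z) M" if f: "f \<in> M" and cf: "(\<lambda>z. cnj z * f z) \<in> M" for f
  proof -
    have "AE z in circle. f z = z * (cnj z * f z)"
    proof (rule AE_I2)
      fix z assume "z \<in> space circle"
      then have "z * cnj z = 1" by (simp flip: complex_norm_square)
      then show "f z = z * (cnj z * f z)" by (simp flip: mult.assoc)
    qed
    then show ?thesis
      unfolding mult_set_def
      by (intro CollectI conjI bexI[OF _ cf] borel_measurable_integrable[OF invariant_integrable[OF f]])
  qed
  have "\<exists>f\<in>M. f \<notin> mult_set (\<lambda>z. z) M"
    using simple M by (auto simp: invariant_subspace_RL1_def)
  then obtain f where f: "f \<in> M" and "f \<notin> mult_set (\<lambda>z. z) M" ..
  then have cf: "(\<lambda>z. cnj z * f z) \<notin> M" using shift_mem by blast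
  \<comment> \<open>If division by z kept all square integrable elements in \<open>M\<close>, it
    would keep \<open>k * f\<close> there, and by closedness in L1 also the limit
    \<open>f\<close>.\<close>
  have "\<exists>g\<in>M. square_integrable circle g \<and> (\<lambda>z. cnj z * g z) \<notin> M"
  proof (rule ccontr)
    assume "\<not> ?thesis"
    then have *: "(\<lambda>z. cnj z * g z) \<in> M" if "g \<in> M" "square_integrable circle g" for g
      using that by blast
    have f_int: "integrable circle f" and f_sym: "real_symmetric f"
      using invariant_RL1[OF f] by (auto simp: RL1_iff)
    have "(\<lambda>z. cnj z * f z) \<in> M"
    proof (rule invariant_closed)
      have "integrable circle (\<lambda>z. cnj z * f z)"
      proof (rule Bochner_Integration.integrable_bound[OF f_int])
        show "(\<lambda>z. cnj z * f z) \<in> borel_measurable circle"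
          using borel_measurable_integrable[OF f_int] borel_measurable_circle[OF measurable_ident]
          by (intro borel_measurable_times borel_measurable_cnj) (simp_all add: id_def)
      qed (auto simp: norm_mult intro!: AE_I2)
      moreover have "real_symmetric (\<lambda>z. cnj z * f z)"
        by (intro real_symmetric_mult f_sym) (simp add: real_symmetric_def)
      ultimately show "(\<lambda>z. cnj z * f z) \<in> RL1" by (simp add: RL1_iff)
      fix e :: real assume e: "e > 0"
      obtain k where k: "k \<in> RH1" "AE z in circle. cmod (k z) \<le> 1"
        "square_integrable circle (\<lambda>z. k z * f z)" "(LINT z|circle. cmod (f z - k z * f z)) < e"
        by (rule RH1_multiplier_approx[OF invariant_RL1[OF f] e]) (assumption | rule that)+
      have kf: "(\<lambda>z. cnj z * (k z * f z)) \<in> M"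
        by (intro * invariant_bounded_mult k f)
      have "(LINT z|circle. cmod (cnj z * f z - cnj z * (k z * f z))) = (LINT z|circle. cmod (f z - k z * f z))"
        by (intro Bochner_Integration.integral_cong refl) (simp add: norm_mult flip: right_diff_distrib)
      with k(4) show "\<exists>g\<in>M. (LINT z|circle. cmod (cnj z * f z - g z)) < e"
        by (intro bexI[OF _ kf]) simp
    qed
    with cf show False ..
  qed
  then obtain g where g: "g \<in> M" "square_integrable circle g" "(\<lambda>z. cnj z * g z) \<notin> M" by blast
  define N where "N = {u. \<exists>w\<in>M. square_integrable circle w \<and> u = (\<lambda>z. z * w z)}"
  have z_sq: "square_integrable circle (\<lambda>z. z * w z)" if "square_integrable circle w" for w
    by (rule square_integrable_circle_mult[OF that, of _ 1])
      (use borel_measurable_circle[OF measurable_ident] in \<open>auto intro!: AE_I2 simp: id_def\<close>)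
  have N_I: "(\<lambda>z. z * w z) \<in> N" if "w \<in> M" "square_integrable circle w" for w
    using that unfolding N_def by blast
  have N_E: "\<exists>w. w \<in> M \<and> square_integrable circle w \<and> u = (\<lambda>z. z * w z)" if "u \<in> N" for u
    using that unfolding N_def by blast
  have N_M: "u \<in> M" "square_integrable circle u" if "u \<in> N" for u
    using N_E[OF that] invariant_shift z_sq by blast+
  obtain v where v: "square_integrable circle v" "real_symmetric v"
    and orth: "\<And>u. u \<in> N \<Longrightarrow> (LINT z|circle. v z * cnj (u z)) = 0"
    and approx: "\<And>e. e > 0 \<Longrightarrow> \<exists>u\<in>N. (LINT z|circle. (cmod (v z - (g z - u z)))\<^sup>2) < e"
    and const: "AE z in circle. (cmod (v z))\<^sup>2 = (LINT z|circle. (cmod (v z))\<^sup>2)"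
  proof (rule wandering_projection[of N g])
    show "real_symmetric u" if "u \<in> N" for u
      using invariant_RL1[OF N_M(1)[OF that]] by (simp add: RL1_iff)
    show "real_symmetric g" using invariant_RL1[OF g(1)] by (simp add: RL1_iff)
    show "(\<lambda>_. 0) \<in> N"
      using N_I[OF invariant_zero circle.square_integrable_const] by simp
    show "(\<lambda>z. u z + v z) \<in> N" if uv: "u \<in> N" "v \<in> N" for u v
    proof -
      from N_E[OF uv(1)] obtain a where a: "a \<in> M" "square_integrable circle a" "u = (\<lambda>z. z * a z)" by blast
      from N_E[OF uv(2)] obtain b where b: "b \<in> M" "square_integrable circle b" "v = (\<lambda>z. z * b z)" by blast
      have "(\<lambda>z. z * (a z + b z)) \<in> N"
        by (intro N_I invariant_add square_integrable_add a b)
      then show ?thesis by (simp add: a b distrib_left)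
    qed
    show "(\<lambda>z. c *\<^sub>R u z) \<in> N" if u: "u \<in> N" for c u
    proof -
      from N_E[OF u] obtain a where a: "a \<in> M" "square_integrable circle a" "u = (\<lambda>z. z * a z)" by blast
      have "(\<lambda>z. z * (c *\<^sub>R a z)) \<in> N"
        by (intro N_I invariant_scaleR square_integrable_scaleR a)
      then show ?thesis by (simp add: a)
    qed
    show "(\<lambda>z. z * u z) \<in> N" if "u \<in> N" for u
      using N_M[OF that] by (rule N_I)
    show "(\<lambda>z. z * g z) \<in> N" using g(1,2) by (rule N_I)
  qed (assumption | rule N_M g that)+
  define D where "D = (LINT z|circle. (cmod (v z))\<^sup>2)"
  \<comment> \<open>The projection leaves \<open>M\<close> only formally: v is an L2 limit of the
    functions g - u, which lie in \<open>M\<close>.\<close>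
  have vM: "v \<in> M"
  proof (rule invariant_closed_L2[OF v(1)])
    fix e :: real assume "e > 0"
    then obtain u where u: "u \<in> N" "(LINT z|circle. (cmod (v z - (g z - u z)))\<^sup>2) < e"
      using approx by blast
    have "(\<lambda>z. g z + (- 1) *\<^sub>R u z) \<in> M"
      by (intro invariant_add invariant_scaleR g N_M u)
    then have "(\<lambda>z. g z - u z) \<in> M" by simp
    moreover have "square_integrable circle (\<lambda>z. g z - u z)"
      by (intro square_integrable_diff g N_M u)
    ultimately show "\<exists>w\<in>M. square_integrable circle w \<and> (LINT z|circle. (cmod (v z - w z))\<^sup>2) < e"
      using u(2) by (intro bexI[of _ "\<lambda>z. g z - u z"] conjI)
  qed
  \<comment> \<open>If v vanished, \<open>g\<close> would be an L2 limit of functions z w with w in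
    \<open>M\<close>, so \<open>cnj z * g z\<close> would be a limit of such w and hence lie in
    \<open>M\<close>, against the choice of \<open>g\<close>.\<close>
  have "D \<noteq> 0"
  proof
    assume "D = 0"
    then have v0: "AE z in circle. v z = 0" using const by (simp add: D_def)
    have "(\<lambda>z. cnj z * g z) \<in> M"
    proof (rule invariant_closed_L2)
      show "square_integrable circle (\<lambda>z. cnj z * g z)"
        by (rule square_integrable_circle_mult[OF g(2), of _ 1])
          (use borel_measurable_cnj[OF borel_measurable_circle[OF measurable_ident]] in \<open>auto intro!: AE_I2 simp: id_def\<close>)
      fix e :: real assume "e > 0"
      then obtain u where u: "u \<in> N" "(LINT z|circle. (cmod (v z - (g z - u z)))\<^sup>2) < e"
        using approx by blast
      from N_E[OF u(1)] obtain w where w: "w \<in> M" "square_integrable circle w" "u = (\<lambda>z. z * w z)" by blast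
      have "(LINT z|circle. (cmod (cnj z * g z - w z))\<^sup>2) = (LINT z|circle. (cmod (v z - (g z - u z)))\<^sup>2)"
      proof (rule integral_cong_AE)
        show "AE z in circle. (cmod (cnj z * g z - w z))\<^sup>2 = (cmod (v z - (g z - u z)))\<^sup>2"
          using v0 AE_circle_norm
        proof eventually_elim
          case (elim z)
          have "cnj z * z = 1" using elim(2) by (simp add: mult.commute flip: complex_norm_square)
          then have "cnj z * g z - w z = cnj z * (g z - u z)"
            by (simp add: w(3) right_diff_distrib flip: mult.assoc)
          then show ?case using elim by (simp add: norm_mult norm_minus_commute)
        qed
        show "(\<lambda>z. (cmod (cnj z * g z - w z))\<^sup>2) \<in> borel_measurable circle"
          using square_integrable_measurable[OF g(2)] square_integrable_measurable[OF w(2)]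
            borel_measurable_cnj[OF borel_measurable_circle[OF measurable_ident]]
          by (simp add: id_def)
        show "(\<lambda>z. (cmod (v z - (g z - u z)))\<^sup>2) \<in> borel_measurable circle"
          using square_integrable_measurable[OF g(2)] square_integrable_measurable[OF N_M(2)[OF u(1)]]
            square_integrable_measurable[OF v(1)] by simp
      qed
      with u(2) w show "\<exists>w\<in>M. square_integrable circle w \<and> (LINT z|circle. (cmod (cnj z * g z - w z))\<^sup>2) < e"
        by (intro bexI[of _ w]) auto
    qed
    with g(3) show False ..
  qed
  moreover have "D \<ge> 0" by (simp add: D_def)
  ultimately have D: "D > 0" by simp
  define U where "U z = (1 / sqrt D) *\<^sub>R v z" for z
  have UM: "U \<in> M" unfolding U_def[abs_def] by (rule invariant_scaleR[OF vM])
  have U1: "AE z in circle. cmod (U z) = 1"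
    using const
  proof eventually_elim
    case (elim z)
    then have "cmod (v z) = sqrt D" unfolding D_def[symmetric] by (metis norm_ge_zero real_sqrt_unique)
    then show ?case using D by (simp add: U_def)
  qed
  have U_int: "integrable circle U" and U_sym: "real_symmetric U"
    using invariant_RL1[OF UM] by (auto simp: RL1_iff)
  note [measurable] = borel_measurable_integrable[OF U_int]
  have "f \<in> mult_set U RH1" if f: "f \<in> M" for f
  proof -
    have f_int: "integrable circle f" and f_sym: "real_symmetric f"
      using invariant_RL1[OF f] by (auto simp: RL1_iff)
    note [measurable] = borel_measurable_integrable[OF f_int]
    \<comment> \<open>As \<open>U\<close> is unimodular, this is the quotient of \<open>f\<close> by
      \<open>U\<close>.\<close>
    define h where "h z = cnj (U z) * f z" for z
    have bnd: "integrable circle (\<lambda>z. cnj (U z) * w z)" if "integrable circle w" for w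
      by (rule Bochner_Integration.integrable_bound[OF that])
        (use U1 borel_measurable_integrable[OF that] in \<open>auto simp: norm_mult elim!: eventually_mono\<close>)
    have h_int: "integrable circle h" unfolding h_def[abs_def] by (rule bnd[OF f_int])
    have "h \<in> RL1"
      using h_int real_symmetric_mult[OF real_symmetric_cnj[OF U_sym] f_sym]
      by (simp add: RL1_iff h_def[abs_def])
    \<comment> \<open>Orthogonality is available only for square integrable elements, so
      \<open>f\<close> is replaced by \<open>k * f\<close>. For that product the coefficient is 0,
      and the error is smaller than the modulus of the coefficient itself.\<close>
    moreover have "fourier_coeff h n = 0" if n: "n < 0" for n
    proof (rule ccontr)
      assume "fourier_coeff h n \<noteq> 0"
      then have "cmod (fourier_coeff h n) > 0" by simp
      then obtain k where k: "k \<in> RH1" "AE z in circle. cmod (k z) \<le> 1"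
        "square_integrable circle (\<lambda>z. k z * f z)"
        "(LINT z|circle. cmod (f z - k z * f z)) < cmod (fourier_coeff h n)"
        by (rule RH1_multiplier_approx[OF invariant_RL1[OF f]]) (assumption | rule that)+
      have kfM: "(\<lambda>z. k z * f z) \<in> M" by (intro invariant_bounded_mult k f)
      have kf_int: "integrable circle (\<lambda>z. k z * f z)" by (rule invariant_integrable[OF kfM])
      define m where "m = nat (- n) - 1"
      have m: "- n = int (Suc m)" using n by (simp add: m_def)
      have zm: "z powi (- n) = z * z ^ m" for z :: complex
        unfolding m by (simp only: power_int_of_nat power_Suc)
      have pow_sq: "square_integrable circle (\<lambda>z. z ^ m * (k z * f z))"
      proof (rule square_integrable_circle_mult[OF k(3), of _ 1])
        show "(\<lambda>z. z ^ m) \<in> borel_measurable circle"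
          using measurable_power_int_circle[of "int m"] by simp
      qed (auto intro!: AE_I2 simp: norm_power)
      \<comment> \<open>A negative index n yields the power -n = m + 1: one factor z is the shift
        built into \<open>N\<close>, the others act within \<open>M\<close>.\<close>
      have "(\<lambda>z. z * (z ^ m * (k z * f z))) \<in> N"
        by (intro N_I invariant_power kfM pow_sq)
      from orth[OF this] have "cnj (LINT z|circle. v z * cnj (z * (z ^ m * (k z * f z)))) = 0"
        by (simp only: complex_cnj_zero)
      then have "(LINT z|circle. cnj (v z * cnj (z * (z ^ m * (k z * f z))))) = 0"
        by (simp only: Bochner_Integration.integral_cnj)
      then have "complex_of_real (1 / sqrt D) * (LINT z|circle. cnj (v z) * (k z * f z) * z powi (- n)) = 0"
        unfolding zm by (simp add: mult_ac)
      then have "(LINT z|circle. complex_of_real (1 / sqrt D) * (cnj (v z) * (k z * f z) * z powi (- n))) = 0"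
        by (simp only: integral_mult_right_zero)
      moreover have "fourier_coeff (\<lambda>z. cnj (U z) * (k z * f z)) n
          = (LINT z|circle. complex_of_real (1 / sqrt D) * (cnj (v z) * (k z * f z) * z powi (- n)))"
        unfolding fourier_coeff_eq[OF borel_measurable_integrable[OF bnd[OF kf_int]]]
        by (simp add: U_def scaleR_conv_of_real mult.assoc)
      ultimately have zero: "fourier_coeff (\<lambda>z. cnj (U z) * (k z * f z)) n = 0" by simp
      have "fourier_coeff h n = fourier_coeff (\<lambda>z. h z - cnj (U z) * (k z * f z)) n"
        using fourier_coeff_diff[OF h_int bnd[OF kf_int], of n] zero by simp
      also have "cmod \<dots> \<le> L1_norm (\<lambda>z. h z - cnj (U z) * (k z * f z))"
        by (intro norm_fourier_coeff_le Bochner_Integration.integrable_diff h_int bnd kf_int)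
      also have "\<dots> = (LINT z|circle. cmod (f z - k z * f z))"
        unfolding L1_norm_def
      proof (rule integral_cong_AE)
        show "AE z in circle. cmod (h z - cnj (U z) * (k z * f z)) = cmod (f z - k z * f z)"
          using U1 by eventually_elim (simp add: h_def norm_mult flip: right_diff_distrib)
      qed (use h_int f_int kf_int bnd[OF kf_int] in auto)
      finally show False using k(4) by simp
    qed
    ultimately have "h \<in> RH1" by (simp add: RH1_iff)
    moreover have "AE z in circle. f z = U z * h z"
      using U1
    proof eventually_elim
      case (elim z)
      then have "U z * cnj (U z) = 1" by (simp flip: complex_norm_square)
      then show ?case by (simp add: h_def flip: mult.assoc)
    qed
    ultimately show ?thesis
      using borel_measurable_integrable[OF f_int] by (auto simp: mult_set_def)
  qed
  then show ?thesis using UM U1 by (intro that[of U]) (auto simp: unimodular_def)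
qed

end

text \<open>The quotient h of the two generators and its inverse, which is \<open>cnj h\<close> by
  unimodularity, are both analytic. So the coefficients of h vanish on either side of 0, and h is
  its mean.\<close>

lemma unimodular_generator_unique:
  assumes U: "U \<in> RL1" "unimodular U" and V: "V \<in> RL1" "unimodular V"
    and eq: "mult_set U RH1 = mult_set V RH1"
  obtains c where "cmod c = 1" "AE z in circle. V z = c * U z"
proof -
  \<comment> \<open>The constant 1 belongs to \<open>RH1\<close>, so each generator is a multiple of
    the other.\<close>
  have self: "W \<in> mult_set W RH1" if "W \<in> RL1" for W
    using one_in_RH1 that by (auto simp: mult_set_def RL1_iff intro!: bexI[of _ "\<lambda>_. 1"])
  have "V \<in> mult_set U RH1" "U \<in> mult_set V RH1"
    using self[OF U(1)] self[OF V(1)] eq by auto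
  then obtain h h' where h: "h \<in> RH1" "AE z in circle. V z = U z * h z"
    and h': "h' \<in> RH1" "AE z in circle. U z = V z * h' z"
    by (auto simp: mult_set_def)
  have h_int: "integrable circle h" and h'_int: "integrable circle h'"
    using h h' by (auto simp: RH1_iff RL1_iff)
  have norm_h: "AE z in circle. cmod (h z) = 1"
    using U(2) V(2) h(2) unfolding unimodular_def by eventually_elim (simp add: norm_mult)
  have h'_eq: "AE z in circle. h' z = cnj (h z)"
    using U(2) norm_h h(2) h'(2) unfolding unimodular_def
  proof eventually_elim
    case (elim z)
    have "U z \<noteq> 0" using elim(1) by auto
    moreover have "U z * h z * h' z = U z"
      by (simp only: elim(3)[symmetric] elim(4)[symmetric])
    ultimately have "h z * h' z = 1" by (simp add: mult.assoc)
    moreover have "cnj (h z) * h z = 1"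
      using elim(2) by (simp add: mult.commute flip: complex_norm_square)
    ultimately show ?case by (metis mult.assoc mult_1 mult.right_neutral)
  qed
  have "fourier_coeff h n = 0" if n: "n \<noteq> 0" for n
  proof (cases "n < 0")
    case True
    then show ?thesis using h(1) by (simp add: RH1_iff)
  next
    case False
    have "fourier_coeff h' (- n) = fourier_coeff (\<lambda>z. cnj (h z)) (- n)"
      by (intro fourier_coeff_cong_AE h'_eq borel_measurable_integrable h'_int integrable_cnj h_int)
    also have "\<dots> = (LINT z|circle. cnj (h z) * z powi (- (- n)))"
      by (intro fourier_coeff_eq borel_measurable_integrable integrable_cnj h_int)
    also have "\<dots> = (LINT z|circle. cnj (h z * z powi (- n)))"
    proof (intro Bochner_Integration.integral_cong refl)
      fix z assume "z \<in> space circle"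
      then have "cnj (z powi (- n)) = z powi (- (- n))" by (intro cnj_powi_circle) simp
      then show "cnj (h z) * z powi (- (- n)) = cnj (h z * z powi (- n))"
        unfolding complex_cnj_mult by (simp only:)
    qed
    also have "\<dots> = cnj (fourier_coeff h n)"
      by (simp only: Bochner_Integration.integral_cnj fourier_coeff_eq[OF borel_measurable_integrable[OF h_int]])
    finally have "cnj (fourier_coeff h n) = fourier_coeff h' (- n)" ..
    also have "\<dots> = 0" using h'(1) False n by (simp add: RH1_iff)
    finally show ?thesis by simp
  qed
  from const_if_fourier_coeff_zero[OF h_int this]
  have c: "AE z in circle. h z = fourier_coeff h 0" .
  show ?thesis
  proof
    show "AE z in circle. V z = fourier_coeff h 0 * U z"
      using c h(2) by eventually_elim (simp add: mult.commute)
    \<comment> \<open>An a.e. statement about a constant; integrating it over the circle, which has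
      mass 1, turns it into an equation of numbers.\<close>
    have "AE z in circle. cmod (fourier_coeff h 0) = 1"
      using c norm_h by eventually_elim simp
    then have "(LINT z|circle. cmod (fourier_coeff h 0)) = (LINT z|circle. 1)"
      by (intro integral_cong_AE) auto
    then show "cmod (fourier_coeff h 0) = 1" by simp
  qed
qed

theorem mainTheorem1:
  fixes M :: "(complex \<Rightarrow> complex) set"
  assumes "simply_invariant_subspace_RL1 M"
  shows "\<exists>U. U \<in> RL1 \<and> unimodular U \<and> M = mult_set U RH1 \<and>
           (\<forall>V. V \<in> RL1 \<and> unimodular V \<and> M = mult_set V RH1 \<longrightarrow>
              (\<exists>c::complex. cmod c = 1 \<and> (AE z in circle. V z = c * U z)))"
proof -
  have M: "invariant_subspace_RL1 M" and "mult_set (\<lambda>z. z) M \<noteq> M"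
    using assms by (auto simp: simply_invariant_subspace_RL1_def)
  then obtain U where U: "U \<in> M" "unimodular U" "M \<subseteq> mult_set U RH1"
    by (rule simply_invariant_generator)
  have UR: "U \<in> RL1" by (rule invariant_RL1[OF M U(1)])
  have MU: "M = mult_set U RH1"
    using invariant_contains_unimodular_mult_RH1[OF M U(1,2)] U(3) by (rule subset_antisym[rotated])
  have "\<exists>c. cmod c = 1 \<and> (AE z in circle. V z = c * U z)"
    if V: "V \<in> RL1" "unimodular V" "M = mult_set V RH1" for V
  proof -
    have "mult_set U RH1 = mult_set V RH1" using MU V(3) by simp
    from unimodular_generator_unique[OF UR U(2) V(1,2) this] show ?thesis by blast
  qed
  with UR U(2) MU show ?thesis by blast
qed

end
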